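(* Let $v(z)$ be the holomorphic continuation of a real analytic function $v(x)$, and let $S(t,z)$ satisfy $\dot S(t,z)=-2iv(z)S'(t,z)$, $S(0,z)=z$, with $\Gamma_t=\{z:\bar z=S(t,z)\}$. Let $x_0$ be a real zero of $v(z)$, and consider the residue $\lambda=\mathrm{Res}(1/v(z);x_0)$. Then the rate of angular rotation of the tangent line to $\Gamma_t$ at the stationary point $x_0$ is constant in time, and is given by $$\frac{d\theta}{dt}=v'(x_0)=\frac1\lambda.$$ The second equality holds when $x_0$ is a simple zero; otherwise, $\Gamma_t$ remains tangent to the real axis at $x_0$, while the curvature and the arclength-derivative of curvature of $\Gamma_t$ (at $x_0$) change at constant rates, as does the Kasner invariant $\mathcal K$, when $\lambda\neq0$: $$\frac{d\mathcal K}{dt}=\frac{(v''(x_0))^2}{v'''(x_0)}=\frac{-2}{3\lambda}.$$ In particular, the rates $\frac{d\theta}{dt}$ and $\frac{d\mathcal K}{dt}$ are local conformal invariants for the continuous reflection equations.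
   Context: Dots denote $\partial/\partial t$ and primes denote $\partial/\partial z$. For each $t$, $S(t,\cdot)$ is the Schwarz function of the analytic curve $\Gamma_t$, i.e. the holomorphic function near $\Gamma_t$ equal to $\bar z$ on $\Gamma_t$; $\Gamma_0$ is the real axis. The displayed initial value problem for $S$ is the normalized form of the continuous reflection equations, which describe a continuous limit of iterated Schwarzian reflection of analytic curves. A stationary point is a real zero $x_0$ of $v$; it lies on $\Gamma_t$ for all $t$. The angle $\theta(t)$ is the angle of the tangent line of $\Gamma_t$ at $x_0$, so that $S'(t,x_0)=e^{-2i\theta(t)}$. The Kasner invariant of a horn angle formed by two curves in first order contact at a point, with signed curvatures $\kappa_1,\kappa_2$, is $\mathcal K=\Theta^2/\Theta_s$, where $\Theta=\kappa_1-\kappa_2$ and the subscript $s$ denotes the derivative with respect to arclength, evaluated at the contact point. Here it is applied to $\Gamma_t$ and the real axis, so $\mathcal K=\kappa^2/\kappa_s$ at $x_0$, where $\kappa$ is the signed curvature of $\Gamma_t$ and $\kappa_s$ its arclength derivative. Conformal invariance refers to replacing the curves $\Gamma_t$ by $\varphi(\Gamma_t)$ and $x_0$ by $\varphi(x_0)$, for $\varphi$ a conformal map defined near $x_0$.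
   Formalization: The equality of (v'')²/v''' with -2/(3λ) is stated only for double zeros (v''(x₀)≠0); it fails at triple zeros, e.g. v=z³/(1+z²), where λ=1 but (v'')²/v'''=0, and for zeros of order at least 4 the quotient is 0/0. *)

theory Defs
  imports "HOL-Complex_Analysis.Complex_Analysis"
begin

text \<open>
  A regular analytic parametrization of the curve \<open>\<Gamma>\<close> near its point \<open>p\<close>: it extends to a
  conformal map \<open>g\<close> of a disc onto a neighbourhood of \<open>p\<close> that flattens \<open>\<Gamma>\<close> to the real
  diameter of the disc. In particular \<open>\<Gamma>\<close> is a regular analytic curve near \<open>p\<close> iff such a
  parametrization exists.
\<close>
definition local_param :: "complex set \<Rightarrow> complex \<Rightarrow> (real \<Rightarrow> complex) \<Rightarrow> bool" where
  "local_param \<Gamma> p \<gamma> \<longleftrightarrow>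
     (\<exists>\<epsilon>>0. \<exists>g. g holomorphic_on ball 0 \<epsilon> \<and> inj_on g (ball 0 \<epsilon>) \<and> g 0 = p \<and>
        (\<forall>s. \<bar>s\<bar> < \<epsilon> \<longrightarrow> \<gamma> s = g (of_real s)) \<and>
        \<Gamma> \<inter> g ` ball 0 \<epsilon> = \<gamma> ` {-\<epsilon><..<\<epsilon>})"

definition velocity :: "(real \<Rightarrow> complex) \<Rightarrow> real \<Rightarrow> complex" where
  "velocity \<gamma> s = vector_derivative \<gamma> (at s)"

definition signed_curvature :: "(real \<Rightarrow> complex) \<Rightarrow> real \<Rightarrow> real" where
  "signed_curvature \<gamma> s =
     Im (cnj (velocity \<gamma> s) * velocity (velocity \<gamma>) s) / norm (velocity \<gamma> s) ^ 3"

definition arclength_deriv :: "(real \<Rightarrow> complex) \<Rightarrow> (real \<Rightarrow> real) \<Rightarrow> real \<Rightarrow> real" where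
  "arclength_deriv \<gamma> f s = deriv f s / norm (velocity \<gamma> s)"

text \<open>
  The angle of the tangent line (an unoriented line, so determined modulo \<open>\<pi>\<close> only).
\<close>
definition tangent_angle :: "complex set \<Rightarrow> complex \<Rightarrow> real \<Rightarrow> bool" where
  "tangent_angle \<Gamma> p \<alpha> \<longleftrightarrow>
     (\<exists>\<gamma>. local_param \<Gamma> p \<gamma> \<and> (\<exists>r::real. velocity \<gamma> 0 = of_real r * cis \<alpha>))"

text \<open>A continuous choice of the tangent angle along a one-parameter family of curves through \<open>p\<close>.\<close>
definition tangent_angle_on ::
    "real set \<Rightarrow> (real \<Rightarrow> complex set) \<Rightarrow> complex \<Rightarrow> (real \<Rightarrow> real) \<Rightarrow> bool" where
  "tangent_angle_on T \<Gamma> p \<theta> \<longleftrightarrow>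
     continuous_on T \<theta> \<and> (\<forall>t\<in>T. tangent_angle (\<Gamma> t) p (\<theta> t))"

text \<open>
  Curvature of \<open>\<Gamma>\<close> at \<open>p\<close> and its arclength derivative, for the orientation in which the
  tangent vector at \<open>p\<close> points in the direction \<open>u\<close>.
\<close>
definition curvature_at :: "complex set \<Rightarrow> complex \<Rightarrow> complex \<Rightarrow> real" where
  "curvature_at \<Gamma> p u =
     (THE k. \<exists>\<gamma>. local_param \<Gamma> p \<gamma> \<and> (\<exists>r>0. velocity \<gamma> 0 = of_real r * u) \<and>
        k = signed_curvature \<gamma> 0)"

definition curvature_s_at :: "complex set \<Rightarrow> complex \<Rightarrow> complex \<Rightarrow> real" where
  "curvature_s_at \<Gamma> p u =
     (THE k. \<exists>\<gamma>. local_param \<Gamma> p \<gamma> \<and> (\<exists>r>0. velocity \<gamma> 0 = of_real r * u) \<and>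
        k = arclength_deriv \<gamma> (signed_curvature \<gamma>) 0)"

text \<open>
  The Kasner invariant \<open>\<Theta>\<^sup>2 / \<Theta>\<^sub>s\<close>, \<open>\<Theta> = \<kappa>\<^sub>1 - \<kappa>\<^sub>2\<close>, of two curves tangent at \<open>p\<close>. Both curves
  are given the same direction at \<open>p\<close>; reversing both changes the sign of \<open>\<Theta>\<close> but not of
  \<open>\<Theta>\<^sub>s\<close>, so the value does not depend on the orientation. By \<open>x / 0 = 0\<close> the value is \<open>0\<close>
  for two coinciding curves.
\<close>
definition kasner :: "complex set \<Rightarrow> complex set \<Rightarrow> complex \<Rightarrow> real" where
  "kasner \<Gamma>1 \<Gamma>2 p =
     (THE k. \<exists>\<gamma>1 \<gamma>2. local_param \<Gamma>1 p \<gamma>1 \<and> local_param \<Gamma>2 p \<gamma>2 \<and>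
        (\<exists>r>0. velocity \<gamma>1 0 = of_real r * velocity \<gamma>2 0) \<and>
        k = (signed_curvature \<gamma>1 0 - signed_curvature \<gamma>2 0)\<^sup>2 /
            (arclength_deriv \<gamma>1 (signed_curvature \<gamma>1) 0 -
             arclength_deriv \<gamma>2 (signed_curvature \<gamma>2) 0))"

end

theory Submission
  imports Defs
begin

text \<open>
  Since \<open>v\<close> vanishes at \<open>x\<^sub>0\<close>, the equation for \<open>S\<close> becomes a triangular system of linear
  differential equations for the Taylor coefficients of \<open>S t\<close> at \<open>x\<^sub>0\<close>. It is solved explicitly
  up to order three, and its uniqueness part shows that \<open>z \<mapsto> cnj (S t z)\<close> is an involution
  near \<open>x\<^sub>0\<close>; hence its fixed point set \<open>\<Gamma> t\<close> really is a regular analytic curve there.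
  For a parametrization \<open>\<gamma>\<close> of \<open>\<Gamma> t\<close>, comparing Taylor coefficients in \<open>cnj \<gamma> = S t \<circ> \<gamma>\<close> gives
  the tangent direction, the curvature and its arclength derivative. The latter two are
  \<open>Im (\<gamma>'' / \<gamma>') / |\<gamma>'|\<close> and \<open>Im (Schwarzian \<gamma>) / |\<gamma>'|\<^sup>2\<close>; the chain rules for \<open>\<gamma>'' / \<gamma>'\<close> and for
  the Schwarzian show that under a conformal map \<open>\<phi>\<close> their differences for two tangent curves
  are divided by \<open>|\<phi>'|\<close> and \<open>|\<phi>'|\<^sup>2\<close>, so that the Kasner invariant is conformally invariant.
\<close>

unbundle no vec_syntax

section \<open>Differentiating Taylor coefficients in a parameter\<close>

text \<open>Cauchy's formula with the path written out over the fixed interval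
  \<open>cbox 0 1\<close>: in this form the theorems on continuity in a parameter and the Leibniz
  rule apply to the integrand.\<close>

lemma higher_deriv_circle_integral:
  assumes "f holomorphic_on ball p R" "r < R" "w \<in> ball p r"
  shows "(deriv ^^ k) f w = fact k / (2 * pi * \<i>) *
    integral (cbox 0 1) (\<lambda>s. f (circlepath p r s) / (circlepath p r s - w) ^ Suc k *
      (2 * of_real pi * \<i> * of_real r * exp (2 * of_real pi * \<i> * of_real s)))"
proof -
  have "cball p r \<subseteq> ball p R" using assms(2) by auto
  then have "f holomorphic_on cball p r"
    using assms(1) by (rule holomorphic_on_subset[rotated])
  then have "continuous_on (cball p r) f" "f holomorphic_on ball p r"
    by (auto intro: holomorphic_on_imp_continuous_on holomorphic_on_subset[OF _ ball_subset_cball])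
  from Cauchy_has_contour_integral_higher_derivative_circlepath[OF this assms(3), of k]
  have "((\<lambda>s. f (circlepath p r s) / (circlepath p r s - w) ^ Suc k *
      vector_derivative (circlepath p r) (at s)) has_integral
      ((2 * pi * \<i>) / (fact k) * (deriv ^^ k) f w)) {0..1}"
    by (simp add: has_contour_integral)
  then have "integral (cbox 0 1) (\<lambda>s. f (circlepath p r s) / (circlepath p r s - w) ^ Suc k *
      (2 * of_real pi * \<i> * of_real r * exp (2 * of_real pi * \<i> * of_real s))) =
      (2 * pi * \<i>) / (fact k) * (deriv ^^ k) f w"
    by (simp add: vector_derivative_circlepath integral_unique)
  then show ?thesis by simp
qed

lemma continuous_circlepath: "continuous_on A (circlepath p r)"
  unfolding circlepath by (intro continuous_intros)

text \<open>Cauchy's formula turns the derivative into an integral over the circle, so joint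
  continuity of \<open>f\<close> on the circle alone suffices. This is what makes the right-hand
  side of the equation for \<open>S\<close> jointly continuous.\<close>

lemma continuous_on_deriv_param:
  fixes f :: "'a::topological_space \<Rightarrow> complex \<Rightarrow> complex"
  assumes cont: "continuous_on (I \<times> sphere p r) (\<lambda>(t, z). f t z)" and "r < R"
    and holo: "\<And>t. t \<in> I \<Longrightarrow> f t holomorphic_on ball p R"
  shows "continuous_on (I \<times> ball p r) (\<lambda>(t, z). deriv (f t) z)"
proof (cases "r > 0")
  case True
  let ?g = "\<lambda>(t, z) s. f t (circlepath p r s) / (circlepath p r s - z) ^ Suc 1 *
      (2 * of_real pi * \<i> * of_real r * exp (2 * of_real pi * \<i> * of_real s))"
  have [simp]: "circlepath p r s \<in> sphere p r" for s
    using True by (simp add: circlepath dist_norm norm_mult)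
  have "continuous_on ((I \<times> ball p r) \<times> cbox 0 1) (\<lambda>x. f (fst (fst x)) (circlepath p r (snd x)))"
    by (rule continuous_on_compose2[OF cont, where f="\<lambda>x. (fst (fst x), circlepath p r (snd x))",
          unfolded split_beta fst_conv snd_conv])
      (auto intro!: continuous_intros continuous_on_compose2[OF continuous_circlepath[of UNIV]]
        simp del: mem_sphere)
  moreover have "circlepath p r (snd x) - snd (fst x) \<noteq> 0"
    if "x \<in> (I \<times> ball p r) \<times> cbox 0 1" for x
  proof -
    have "dist p (circlepath p r (snd x)) = r"
      using True by (simp add: circlepath dist_norm norm_mult)
    then show ?thesis using that by auto
  qed
  ultimately have "continuous_on ((I \<times> ball p r) \<times> cbox 0 1) (\<lambda>(x, s). ?g x s)"
    unfolding split_beta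
    by (intro continuous_intros continuous_on_compose2[OF continuous_circlepath[of UNIV]]) auto
  then have "continuous_on (I \<times> ball p r) (\<lambda>x. fact 1 / (2 * pi * \<i>) * integral (cbox 0 1) (?g x))"
    by (intro continuous_on_mult continuous_on_const integral_continuous_on_param)
  then show ?thesis
    by (rule continuous_on_eq)
      (use higher_deriv_circle_integral[OF holo assms(2), where k=1] in auto)
qed (simp add: ball_empty)

text \<open>The Leibniz rule under Cauchy's integral: taking a Taylor coefficient at
  \<open>p\<close> commutes with differentiating in the parameter. As \<open>I\<close> is only
  convex, one-sided derivatives at its end points are included.\<close>

lemma higher_deriv_has_vector_derivative:
  fixes f f' :: "real \<Rightarrow> complex \<Rightarrow> complex"
  assumes r: "0 < r" "r < R" and I: "convex I" "t0 \<in> I"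
    and holo: "\<And>t. t \<in> I \<Longrightarrow> f t holomorphic_on ball p R" "\<And>t. t \<in> I \<Longrightarrow> f' t holomorphic_on ball p R"
    and deriv: "\<And>t z. t \<in> I \<Longrightarrow> z \<in> sphere p r \<Longrightarrow>
      ((\<lambda>\<tau>. f \<tau> z) has_vector_derivative f' t z) (at t within I)"
    and cont: "continuous_on (I \<times> sphere p r) (\<lambda>(t, z). f' t z)"
  shows "((\<lambda>t. (deriv ^^ n) (f t) p) has_vector_derivative (deriv ^^ n) (f' t0) p) (at t0 within I)"
proof -
  define k where "k s = 1 / (circlepath p r s - p) ^ Suc n *
      (2 * of_real pi * \<i> * of_real r * exp (2 * of_real pi * \<i> * of_real s))" for s
  have sph: "circlepath p r s \<in> sphere p r" for s
    using r by (simp add: circlepath dist_norm norm_mult)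
  have "circlepath p r s \<noteq> p" for s using sph[of s] r by auto
  then have ck: "continuous_on A k" for A
    unfolding k_def by (intro continuous_intros continuous_circlepath) auto
  have "((\<lambda>t. integral (cbox 0 1) (\<lambda>s. f t (circlepath p r s) * k s)) has_vector_derivative
      integral (cbox 0 1) (\<lambda>s. f' t0 (circlepath p r s) * k s)) (at t0 within I)"
  proof (rule leibniz_rule_vector_derivative[OF _ _ _ I(2,1)])
    show "((\<lambda>t. f t (circlepath p r s) * k s) has_vector_derivative
        f' t (circlepath p r s) * k s) (at t within I)" if "t \<in> I" for t s
      by (intro has_vector_derivative_mult_left deriv that sph)
    show "(\<lambda>s. f t (circlepath p r s) * k s) integrable_on cbox 0 1" if "t \<in> I" for t
    proof (rule integrable_continuous)
      have "continuous_on (sphere p r) (f t)"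
        by (intro holomorphic_on_imp_continuous_on holomorphic_on_subset[OF holo(1)[OF that]])
          (use r in auto)
      then show "continuous_on (cbox 0 1) (\<lambda>s. f t (circlepath p r s) * k s)"
        by (intro continuous_on_mult ck)
          (rule continuous_on_compose2[OF _ continuous_circlepath], use sph in auto)
    qed
    have "continuous_on (I \<times> cbox 0 1) (\<lambda>x. f' (fst x) (circlepath p r (snd x)))"
      by (rule continuous_on_compose2[OF cont, where f="\<lambda>x. (fst x, circlepath p r (snd x))",
          unfolded split_beta fst_conv snd_conv])
      (use sph in \<open>auto intro!: continuous_intros continuous_on_compose2[OF continuous_circlepath[of UNIV]]
        simp del: mem_sphere\<close>)
    then show "continuous_on (I \<times> cbox 0 1) (\<lambda>(t, s). f' t (circlepath p r s) * k s)"
      unfolding split_beta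
      by (intro continuous_on_mult continuous_on_compose2[OF ck[of UNIV]] continuous_intros) auto
  qed
  then have "((\<lambda>t. fact n / (2 * pi * \<i>) * integral (cbox 0 1) (\<lambda>s. f t (circlepath p r s) * k s)) has_vector_derivative
      fact n / (2 * pi * \<i>) * integral (cbox 0 1) (\<lambda>s. f' t0 (circlepath p r s) * k s)) (at t0 within I)"
    by (rule has_vector_derivative_mult_right)
  moreover have "(deriv ^^ n) g p = fact n / (2 * pi * \<i>) * integral (cbox 0 1) (\<lambda>s. g (circlepath p r s) * k s)"
    if "g holomorphic_on ball p R" for g
    using higher_deriv_circle_integral[OF that r(2), of p n] r(1) by (simp add: k_def)
  ultimately show ?thesis
    using holo I by (auto elim!: has_vector_derivative_transform[rotated -1])
qed

section \<open>The transport equation for power series\<close>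

text \<open>The Taylor series at 0 of \<open>z \<mapsto> cnj (f (cnj z))\<close> when
  \<open>F\<close> is that of \<open>f\<close>; unlike \<open>cnj \<circ> f\<close>, this function
  is again holomorphic.\<close>

definition fps_cnj :: "complex fps \<Rightarrow> complex fps" where
  "fps_cnj F = Abs_fps (\<lambda>n. cnj (F $ n))"

lemma fps_cnj_nth [simp]: "fps_cnj F $ n = cnj (F $ n)"
  by (simp add: fps_cnj_def)

lemma fps_cnj_mult: "fps_cnj (F * G) = fps_cnj F * fps_cnj G"
  by (simp add: fps_eq_iff fps_mult_nth)

lemma fps_cnj_deriv: "fps_cnj (fps_deriv F) = fps_deriv (fps_cnj F)"
  by (simp add: fps_eq_iff)

lemma fps_cnj_const: "fps_cnj (fps_const c) = fps_const (cnj c)"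
  by (simp add: fps_eq_iff)

lemma fps_cnj_X: "fps_cnj fps_X = fps_X"
  by (simp add: fps_eq_iff fps_X_def)

text \<open>Differentiation in \<open>t\<close> is coefficientwise, so the uniqueness arguments
  below are formal and need no control of radii of convergence.\<close>

definition fps_vderiv :: "real set \<Rightarrow> (real \<Rightarrow> complex fps) \<Rightarrow> (real \<Rightarrow> complex fps) \<Rightarrow> bool" where
  "fps_vderiv T A A' \<longleftrightarrow>
     (\<forall>t\<in>T. \<forall>n. ((\<lambda>\<tau>. A \<tau> $ n) has_vector_derivative A' t $ n) (at t within T))"

lemma fps_vderiv_cong:
  "fps_vderiv T A A' \<Longrightarrow> (\<And>t. t \<in> T \<Longrightarrow> A' t = B' t) \<Longrightarrow> fps_vderiv T A B'"
  by (simp add: fps_vderiv_def)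

lemma fps_vderiv_const: "fps_vderiv T (\<lambda>_. C) (\<lambda>_. 0)"
  by (simp add: fps_vderiv_def)

lemma fps_vderiv_diff:
  assumes "fps_vderiv T A A'" "fps_vderiv T B B'"
  shows "fps_vderiv T (\<lambda>t. A t - B t) (\<lambda>t. A' t - B' t)"
  using assms by (auto simp: fps_vderiv_def intro!: has_vector_derivative_diff)

lemma fps_vderiv_mult:
  assumes "fps_vderiv T A A'" "fps_vderiv T B B'"
  shows "fps_vderiv T (\<lambda>t. A t * B t) (\<lambda>t. A t * B' t + A' t * B t)"
  unfolding fps_vderiv_def
proof (intro ballI allI)
  fix t n assume t: "t \<in> T"
  have "((\<lambda>\<tau>. \<Sum>i=0..n. A \<tau> $ i * B \<tau> $ (n - i)) has_vector_derivative
      (\<Sum>i=0..n. A t $ i * B' t $ (n - i) + A' t $ i * B t $ (n - i))) (at t within T)"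
    using assms t by (intro has_vector_derivative_sum has_vector_derivative_mult)
      (auto simp: fps_vderiv_def)
  then show "((\<lambda>\<tau>. (A \<tau> * B \<tau>) $ n) has_vector_derivative (A t * B' t + A' t * B t) $ n) (at t within T)"
    by (simp add: fps_mult_nth sum.distrib)
qed

lemma fps_vderiv_deriv:
  assumes "fps_vderiv T A A'"
  shows "fps_vderiv T (\<lambda>t. fps_deriv (A t)) (\<lambda>t. fps_deriv (A' t))"
  using assms unfolding fps_vderiv_def
  by (auto intro!: has_vector_derivative_mult_right simp del: of_nat_Suc of_nat_add)

lemma fps_vderiv_cnj:
  assumes "fps_vderiv T A A'"
  shows "fps_vderiv T (\<lambda>t. fps_cnj (A t)) (\<lambda>t. fps_cnj (A' t))"
  using assms unfolding fps_vderiv_def by (auto intro!: has_vector_derivative_cnj)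

lemma fps_vderiv_power:
  assumes "fps_vderiv T B B'"
  shows "fps_vderiv T (\<lambda>t. B t ^ k) (\<lambda>t. of_nat k * B t ^ (k - 1) * B' t)"
proof (induction k)
  case 0
  then show ?case using fps_vderiv_const[of T 1] by simp
next
  case (Suc k)
  have "B t * (of_nat k * B t ^ (k - 1) * B' t) + B' t * B t ^ k = of_nat (Suc k) * B t ^ (Suc k - 1) * B' t" for t
    by (cases k) (simp_all add: algebra_simps)
  then show ?case using fps_vderiv_mult[OF assms Suc] by simp
qed

text \<open>The chain rule. The \<open>n\<close>-th coefficient of the composition is a sum over
  \<open>i \<le> n\<close>, differentiated termwise; the zero constant terms of \<open>B t\<close>
  and \<open>B' t\<close> serve to match the result with the double sum for the product on the
  right.\<close>

lemma fps_vderiv_compose: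
  assumes A: "fps_vderiv T A A'" and B: "fps_vderiv T B B'"
    and B0: "\<And>t. t \<in> T \<Longrightarrow> B t $ 0 = 0" "\<And>t. t \<in> T \<Longrightarrow> B' t $ 0 = 0"
  shows "fps_vderiv T (\<lambda>t. A t oo B t) (\<lambda>t. (A' t oo B t) + (fps_deriv (A t) oo B t) * B' t)"
  unfolding fps_vderiv_def
proof (intro ballI allI)
  fix t n assume t: "t \<in> T"
  have pw: "fps_vderiv T (\<lambda>t. B t ^ i) (\<lambda>t. of_nat i * B t ^ (i - 1) * B' t)" for i
    by (rule fps_vderiv_power[OF B])
  have "((\<lambda>\<tau>. \<Sum>i=0..n. A \<tau> $ i * (B \<tau> ^ i) $ n) has_vector_derivative
      (\<Sum>i=0..n. A t $ i * (of_nat i * B t ^ (i - 1) * B' t) $ n + A' t $ i * (B t ^ i) $ n)) (at t within T)"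
    using A pw t by (intro has_vector_derivative_sum has_vector_derivative_mult)
      (auto simp: fps_vderiv_def)
  moreover have "((fps_deriv (A t) oo B t) * B' t) $ n =
      (\<Sum>i=0..n. A t $ i * (of_nat i * B t ^ (i - 1) * B' t) $ n)"
  proof -
    \<comment> \<open>\<open>B t ^ j\<close> has order at least \<open>j\<close>, and
      \<open>B' t\<close> has no constant term (for \<open>k \<ge> n\<close> the truncated
      difference is 0). Hence \<open>j\<close> may range over \<open>j < n\<close> for every
      \<open>k\<close>, after which the two sums can be interchanged.\<close>
    have z: "(B t ^ j) $ k * B' t $ (n - k) = 0" if "k < j \<or> k \<ge> n" for j k
      using that B0[OF t] by (auto simp: startsby_zero_power_prefix)
    have "((fps_deriv (A t) oo B t) * B' t) $ n =
      (\<Sum>k=0..n. \<Sum>j=0..k. fps_deriv (A t) $ j * ((B t ^ j) $ k * B' t $ (n - k)))"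
      by (simp add: fps_mult_nth fps_compose_nth sum_distrib_right mult.assoc)
    also have "\<dots> = (\<Sum>k=0..n. \<Sum>j<n. fps_deriv (A t) $ j * ((B t ^ j) $ k * B' t $ (n - k)))"
    proof (rule sum.cong[OF refl])
      fix k assume k: "k \<in> {0..n}"
      show "(\<Sum>j=0..k. fps_deriv (A t) $ j * ((B t ^ j) $ k * B' t $ (n - k))) =
          (\<Sum>j<n. fps_deriv (A t) $ j * ((B t ^ j) $ k * B' t $ (n - k)))"
      proof (cases "k < n")
        case True
        then show ?thesis
          by (intro sum.mono_neutral_left) (auto simp: z)
      next
        case False
        then have "B' t $ (n - k) = 0" using B0[OF t] by simp
        then show ?thesis by simp
      qed
    qed
    also have "\<dots> = (\<Sum>j<n. fps_deriv (A t) $ j * (B t ^ j * B' t) $ n)"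
      by (subst sum.swap) (simp add: fps_mult_nth sum_distrib_left)
    also have "\<dots> = (\<Sum>j<n. A t $ Suc j * (of_nat (Suc j) * (B t ^ j * B' t)) $ n)"
    proof -
      have "(of_nat m * F) $ n = of_nat m * F $ n" for m and F :: "complex fps"
        by (metis fps_of_nat fps_mult_left_const_nth)
      then show ?thesis by (simp only: fps_deriv_nth Suc_eq_plus1[symmetric] mult.assoc mult.left_commute)
    qed
    \<comment> \<open>Index shift \<open>i = Suc j\<close>; the added term \<open>i = 0\<close>
      vanishes by its factor \<open>of_nat 0\<close>.\<close>
    also have "\<dots> = (\<Sum>i=0..n. A t $ i * (of_nat i * (B t ^ (i - 1) * B' t)) $ n)"
      by (simp add: sum.atMost_shift atLeast0AtMost del: of_nat_Suc)
    finally show ?thesis by (simp add: mult.assoc)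
  qed
  ultimately show "((\<lambda>\<tau>. (A \<tau> oo B \<tau>) $ n) has_vector_derivative
      ((A' t oo B t) + (fps_deriv (A t) oo B t) * B' t) $ n) (at t within T)"
    by (simp add: fps_compose_nth sum.distrib add.commute)
qed

text \<open>Multiplying by the integrating factor \<open>exp (- c * of_real t)\<close> gives a
  function with zero derivative on a convex set, hence a constant.\<close>

lemma linear_ode_zero:
  fixes u :: "real \<Rightarrow> complex"
  assumes "convex T" "a \<in> T" "t \<in> T" "u a = 0"
    and der: "\<And>t. t \<in> T \<Longrightarrow> (u has_vector_derivative c * u t) (at t within T)"
  shows "u t = 0"
proof -
  let ?w = "\<lambda>t. u t * exp (- c * of_real t)"
  have "(?w has_vector_derivative 0) (at t within T)" if "t \<in> T" for t
  proof -
    have "((\<lambda>t. exp (- c * of_real t)) has_vector_derivative - c * exp (- c * of_real t)) (at t within T)"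
      by (rule has_vector_derivative_real_field) (auto intro!: derivative_eq_intros)
    from has_vector_derivative_mult[OF der[OF that] this] show ?thesis
      by (simp add: algebra_simps)
  qed
  then have "(?w has_derivative (\<lambda>h. 0)) (at t within T)" if "t \<in> T" for t
    using that by (auto simp: has_vector_derivative_def)
  from has_derivative_zero_unique[OF assms(1) this assms(3,2)] show ?thesis
    using assms by simp
qed

text \<open>Since \<open>V $ 0 = 0\<close>, the \<open>n\<close>-th coefficient of
  \<open>V * fps_deriv (G t)\<close> involves no coefficient of \<open>G t\<close> beyond the
  \<open>n\<close>-th. By strong induction the lower ones vanish, which leaves a scalar homogeneous
  linear equation for the \<open>n\<close>-th.\<close>

lemma fps_transport_zero:
  assumes T: "convex T" "0 \<in> T" and V0: "V $ 0 = 0"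
    and der: "fps_vderiv T G (\<lambda>t. fps_const c * (V * fps_deriv (G t)))" and G0: "G 0 = 0"
    and t: "t \<in> T"
  shows "G t = 0"
proof -
  have "\<forall>t\<in>T. G t $ n = 0" for n
  proof (induction n rule: less_induct)
    case (less n)
    have *: "(fps_const c * (V * fps_deriv (G t))) $ n = (c * V $ 1 * of_nat n) * G t $ n" if "t \<in> T" for t
    proof -
      have "V $ i * fps_deriv (G t) $ (n - i) = 0" if "i \<in> {0..n} - {1}" for i
      proof (cases "i = 0")
        case False
        then have "Suc (n - i) < n" using that by auto
        then show ?thesis using less \<open>t \<in> T\<close> by simp
      qed (use V0 in simp)
      then have "(\<Sum>i=0..n. V $ i * fps_deriv (G t) $ (n - i)) =
          (\<Sum>i\<in>{0..n} \<inter> {1}. V $ i * fps_deriv (G t) $ (n - i))"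
        by (intro sum.mono_neutral_right) auto
      \<comment> \<open>For \<open>n = 0\<close> the index set is empty, in agreement with the
        factor \<open>of_nat n\<close>.\<close>
      also have "\<dots> = V $ 1 * of_nat n * G t $ n" by (cases n) auto
      finally have "(V * fps_deriv (G t)) $ n = V $ 1 * of_nat n * G t $ n"
        by (simp only: fps_mult_nth)
      then show ?thesis by (simp only: fps_mult_left_const_nth mult.assoc)
    qed
    show ?case
    proof
      fix t assume t: "t \<in> T"
      have "((\<lambda>\<tau>. G \<tau> $ n) has_vector_derivative (c * V $ 1 * of_nat n) * G t $ n) (at t within T)"
        if "t \<in> T" for t
        using der that unfolding fps_vderiv_def by (metis * that)
      from linear_ode_zero[OF T t _ this] show "G t $ n = 0"
        using G0 by simp
    qed
  qed
  then show ?thesis using t by (simp add: fps_eq_iff)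
qed

lemma fps_vderiv_zero_const:
  assumes T: "convex T" "0 \<in> T" "fps_vderiv T G (\<lambda>t. 0)" "t \<in> T"
  shows "G t = G 0"
proof -
  \<comment> \<open>A zero right-hand side is read as the transport equation with
    \<open>c = 0\<close> and \<open>V = 0\<close>.\<close>
  have "fps_vderiv T (\<lambda>t. G t - G 0) (\<lambda>t. fps_const 0 * (0 * fps_deriv (G t - G 0)))"
    using fps_vderiv_diff[OF assms(3) fps_vderiv_const] by simp
  from fps_transport_zero[OF T(1,2) _ this _ T(4)] show ?thesis by simp
qed

text \<open>
  Both \<open>V \<circ> s - V s'\<close> (the flow preserves its own vector field) and, given that this vanishes,
  the derivative of \<open>fps_cnj s \<circ> s\<close> are seen to be zero from the transport equation.
\<close>
lemma fps_flow_reflection: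
  assumes T: "convex T" "0 \<in> T" and V: "V $ 0 = 0" "fps_cnj V = V"
    and der: "fps_vderiv T s (\<lambda>t. fps_const (- 2 * \<i>) * (V * fps_deriv (s t)))"
    and s: "s 0 = fps_X" "\<And>t. t \<in> T \<Longrightarrow> s t $ 0 = 0" and t: "t \<in> T"
  shows "fps_cnj (s t) oo s t = fps_X"
proof -
  define c where "c = fps_const (- 2 * \<i>)"
  have dc: "fps_deriv c = 0"
    by (simp only: c_def fps_deriv_const)
  have der: "fps_vderiv T s (\<lambda>t. c * (V * fps_deriv (s t)))"
    using der by (simp only: c_def)
  have z: "(c * (V * fps_deriv (s t))) $ 0 = 0" for t using V by simp
  have eqv: "V oo s t = V * fps_deriv (s t)" if "t \<in> T" for t
  proof -
    let ?G = "\<lambda>t. (V oo s t) - V * fps_deriv (s t)"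
    let ?G' = "\<lambda>t. ((0 oo s t) + (fps_deriv V oo s t) * (c * (V * fps_deriv (s t)))) -
      (V * fps_deriv (c * (V * fps_deriv (s t))) + 0 * fps_deriv (s t))"
    have "fps_vderiv T ?G ?G'"
      by (intro fps_vderiv_diff fps_vderiv_compose fps_vderiv_mult fps_vderiv_const
        fps_vderiv_deriv der s(2) z)
    \<comment> \<open>The term \<open>(fps_deriv V oo s t) * fps_deriv (s t)\<close> is the
      derivative of \<open>V oo s t\<close>, so \<open>c * V\<close> can be factored out and the
      derivative of \<open>?G t\<close> remains.\<close>
    moreover have "?G' t = c * (V * fps_deriv (?G t))" if "t \<in> T" for t
      by (simp add: dc fps_compose_deriv[OF s(2)[OF that]] algebra_simps)
    ultimately have "fps_vderiv T ?G (\<lambda>t. c * (V * fps_deriv (?G t)))"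
      by (rule fps_vderiv_cong)
    from fps_transport_zero[OF T V(1) this[unfolded c_def] _ that] show ?thesis using s by simp
  qed
  let ?F = "\<lambda>t. fps_cnj (s t) oo s t"
  let ?F' = "\<lambda>t. (fps_cnj (c * (V * fps_deriv (s t))) oo s t) +
     (fps_deriv (fps_cnj (s t)) oo s t) * (c * (V * fps_deriv (s t)))"
  have "fps_vderiv T ?F ?F'"
    by (intro fps_vderiv_compose fps_vderiv_cnj der s(2) z)
  moreover have "?F' t = 0" if "t \<in> T" for t
  proof -
    \<comment> \<open>Conjugation reverses the sign of the imaginary constant, so the conjugate
      series flows backwards in time; with \<open>eqv\<close> the two terms of \<open>?F'\<close>
      then cancel.\<close>
    have "fps_cnj c = - c" "- c oo s t = - c"
      unfolding c_def by (simp_all add: fps_cnj_const)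
    then have "fps_cnj (c * (V * fps_deriv (s t))) oo s t =
      - c * ((V oo s t) * (fps_deriv (fps_cnj (s t)) oo s t))"
      by (simp only: fps_cnj_mult fps_cnj_deriv V fps_compose_mult_distrib[OF s(2)[OF that]])
    then show ?thesis using eqv[OF that] by (simp add: algebra_simps)
  qed
  ultimately have "fps_vderiv T ?F (\<lambda>_. 0)"
    by (rule fps_vderiv_cong)
  from fps_vderiv_zero_const[OF T this t] show ?thesis
    by (simp add: s fps_cnj_X)
qed

text \<open>Triangularity allows solving for one coefficient after another: each claimed solution is
  subtracted from the coefficient, and the difference solves a homogeneous linear equation with zero
  initial value.\<close>

lemma fps_flow_coeffs:
  assumes T: "convex T" "0 \<in> T" and V: "V $ 0 = 0"
    and der: "fps_vderiv T s (\<lambda>t. fps_const (- 2 * \<i>) * (V * fps_deriv (s t)))"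
    and s: "s 0 = fps_X" and t: "t \<in> T"
  shows "s t $ 1 = exp (- 2 * \<i> * V $ 1 * of_real t)"
    and "V $ 1 = 0 \<Longrightarrow> s t $ 2 = - 2 * \<i> * V $ 2 * of_real t"
    and "V $ 1 = 0 \<Longrightarrow> s t $ 3 = - 2 * \<i> * V $ 3 * of_real t + (s t $ 2)\<^sup>2"
proof -
  have d: "((\<lambda>\<tau>. s \<tau> $ n) has_vector_derivative - 2 * \<i> *
      (\<Sum>i=0..n. V $ i * (of_nat (n - i + 1) * s t $ (n - i + 1)))) (at t within T)"
    if "t \<in> T" for t n
  proof -
    have "((\<lambda>\<tau>. s \<tau> $ n) has_vector_derivative - 2 * \<i> * (V * fps_deriv (s t)) $ n) (at t within T)"
      using der that by (simp only: fps_vderiv_def fps_mult_left_const_nth)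
    then show ?thesis by (simp only: fps_mult_nth fps_deriv_nth)
  qed
  let ?c = "- 2 * \<i> * V $ 1"
  have e: "((\<lambda>t. exp (?c * of_real t)) has_vector_derivative ?c * exp (?c * of_real t)) (at t within T)" for t
    by (rule has_vector_derivative_real_field) (auto intro!: derivative_eq_intros)
  have d1: "((\<lambda>\<tau>. s \<tau> $ 1) has_vector_derivative ?c * s t $ 1) (at t within T)" if "t \<in> T" for t
    using d[OF that, of 1] by (simp add: V mult.assoc)
  have "s t $ 1 - exp (?c * of_real t) = 0" if "t \<in> T" for t
    by (rule linear_ode_zero[OF T that, where c="?c"])
      (use has_vector_derivative_diff[OF d1 e] in \<open>auto simp: s right_diff_distrib\<close>)
  then have 1: "s t $ 1 = exp (?c * of_real t)" if "t \<in> T" for t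
    using that by (simp only: right_minus_eq)
  show "s t $ 1 = exp (?c * of_real t)" by (rule 1[OF t])
  { assume V1: "V $ 1 = 0"
    have s1: "s t $ Suc 0 = 1" if "t \<in> T" for t using 1[OF that] V1 by simp
    have l: "((\<lambda>t. a * of_real t) has_vector_derivative a) (at t within T)" for t and a :: complex
      by (rule has_vector_derivative_real_field) (auto intro!: derivative_eq_intros)
    have d2: "((\<lambda>\<tau>. s \<tau> $ 2) has_vector_derivative - 2 * \<i> * V $ 2) (at t within T)" if "t \<in> T" for t
      using d[OF that, of 2] s1[OF that] by (simp add: V V1[simplified] numeral_2_eq_2 mult.assoc)
    have "s t $ 2 - - 2 * \<i> * V $ 2 * of_real t = 0" if "t \<in> T" for t
      by (rule linear_ode_zero[OF T that, where c=0])
        (use has_vector_derivative_diff[OF d2 l[of "- 2 * \<i> * V $ 2"]] in \<open>auto simp: s\<close>)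
    then have 2: "s t $ 2 = - 2 * \<i> * V $ 2 * of_real t" if "t \<in> T" for t
      using that by (simp only: right_minus_eq)
    show "s t $ 2 = - 2 * \<i> * V $ 2 * of_real t" by (rule 2[OF t])
    have q: "((\<lambda>t. a * of_real t + (b * of_real t)\<^sup>2) has_vector_derivative a + 2 * b\<^sup>2 * of_real t) (at t within T)"
      for t and a b :: complex
      by (rule has_vector_derivative_real_field)
        (auto intro!: derivative_eq_intros simp: power2_eq_square algebra_simps)
    \<comment> \<open>The contribution \<open>2 * V $ 2 * s t $ 2\<close> of the second coefficient,
      with \<open>s t $ 2\<close> linear in \<open>t\<close>, integrates to exactly
      \<open>(s t $ 2)\<^sup>2\<close>.\<close>
    have d3: "((\<lambda>\<tau>. s \<tau> $ 3) has_vector_derivative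
        - 2 * \<i> * V $ 3 + 2 * (- 2 * \<i> * V $ 2)\<^sup>2 * of_real t) (at t within T)" if "t \<in> T" for t
      using d[OF that, of 3] s1[OF that] 2[OF that]
      by (simp add: V V1[simplified] numeral_2_eq_2 numeral_3_eq_3 algebra_simps)
    have "s t $ 3 - (- 2 * \<i> * V $ 3 * of_real t + (- 2 * \<i> * V $ 2 * of_real t)\<^sup>2) = 0" if "t \<in> T" for t
      by (rule linear_ode_zero[OF T that, where c=0])
        (use has_vector_derivative_diff[OF d3 q[of "- 2 * \<i> * V $ 3" "- 2 * \<i> * V $ 2"]] in \<open>auto simp: s\<close>)
    then show "s t $ 3 = - 2 * \<i> * V $ 3 * of_real t + (s t $ 2)\<^sup>2"
      using 2[OF t] t by (simp only: right_minus_eq) }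
qed

section \<open>Curvature of parametrized curves\<close>

lemma has_fps_expansion_cnj:
  assumes "f has_fps_expansion F"
  shows "(\<lambda>z. cnj (f (cnj z))) has_fps_expansion fps_cnj F"
proof (rule has_fps_expansionI)
  from has_fps_expansion_imp_holomorphic[OF assms] obtain A
    where A: "open A" "0 \<in> A" "f holomorphic_on A" by metis
  then obtain r where r: "r > 0" "ball 0 r \<subseteq> A" by (meson openE)
  have "f holomorphic_on eball 0 (ereal r)"
    using A r by (auto intro: holomorphic_on_subset)
  then have "(\<lambda>n. F $ n * z ^ n) sums f z" if "norm z < r" for z
    using has_fps_expansion_imp_sums_complex[OF assms, of r z] that by simp
  then have "(\<lambda>n. cnj (F $ n * cnj z ^ n)) sums cnj (f (cnj z))" if "norm z < r" for z
    using that by (subst sums_cnj) simp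
  then have "(\<lambda>n. fps_cnj F $ n * z ^ n) sums cnj (f (cnj z))" if "norm z < r" for z
    using that by simp
  moreover have "eventually (\<lambda>z::complex. z \<in> ball 0 r) (nhds 0)"
    using r by (intro eventually_nhds_in_open) auto
  ultimately show "eventually (\<lambda>z. (\<lambda>n. fps_cnj F $ n * z ^ n) sums cnj (f (cnj z))) (nhds 0)"
    by (auto elim!: eventually_mono)
qed

text \<open>The identity theorem on the positive reals, which accumulate at 0. It converts relations
  that hold only along a curve, for real values of its parameter, into identities of power
  series.\<close>

lemma fps_expansion_unique_on_reals:
  fixes f g :: "complex \<Rightarrow> complex"
  assumes F: "f has_fps_expansion F" and G: "g has_fps_expansion G"
    and eq: "\<forall>\<^sub>F s in nhds (0::real). f (of_real s) = g (of_real s)"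
  shows "F = G"
proof (rule ccontr)
  assume ne: "F \<noteq> G"
  have D: "(\<lambda>z. f z - g z) has_fps_expansion (F - G)"
    by (intro has_fps_expansion_diff F G)
  from has_fps_expansion_imp_holomorphic[OF this] obtain A
    where A: "open A" "0 \<in> A" "(\<lambda>z. f z - g z) holomorphic_on A" by metis
  then obtain r where r: "r > 0" "ball 0 r \<subseteq> A" by (meson openE)
  obtain d where d: "d > 0" "\<And>s::real. \<bar>s\<bar> < d \<Longrightarrow> f (of_real s) = g (of_real s)"
    using eq by (auto simp: eventually_nhds_metric)
  let ?U = "complex_of_real ` {0<..<min r d}"
  have lim: "(0::complex) islimpt ?U"
    unfolding islimpt_approachable
  proof (intro allI impI)
    fix e :: real assume "e > 0"
    then show "\<exists>x'\<in>?U. x' \<noteq> 0 \<and> dist x' 0 < e"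
      using r d by (intro bexI[of _ "of_real (min (min r d) e / 2)"] imageI) (auto simp: min_def)
  qed
  have "f z - g z = 0" if "z \<in> ball 0 r" for z
    by (rule analytic_continuation[of _ "ball 0 r" ?U 0])
      (use A r d lim that in \<open>auto intro: holomorphic_on_subset\<close>)
  then have "\<forall>\<^sub>F z in nhds 0. f z - g z = 0"
    unfolding eventually_nhds using r by (intro exI[of _ "ball 0 r"]) auto
  then have "(\<lambda>z. f z - g z) has_fps_expansion 0"
    by (simp add: has_fps_expansion_0_iff)
  with D have "F - G = 0" by (metis fps_expansion_eqI)
  with ne show False by simp
qed

lemma fps_compose_nth_1_2_3:
  fixes A B :: "complex fps"
  assumes "B $ 0 = 0"
  shows "(A oo B) $ 1 = A $ 1 * B $ 1"
    and "(A oo B) $ 2 = A $ 1 * B $ 2 + A $ 2 * (B $ 1)\<^sup>2"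
    and "(A oo B) $ 3 = A $ 1 * B $ 3 + 2 * A $ 2 * B $ 1 * B $ 2 + A $ 3 * (B $ 1) ^ 3"
proof -
  note s = fps_compose_nth fps_mult_nth power2_eq_square power3_eq_cube assms
    numeral_2_eq_2 numeral_3_eq_3
  have 2: "(B ^ 2) $ 2 = (B $ 1)\<^sup>2" "(B ^ 2) $ 3 = 2 * B $ 1 * B $ 2" "(B ^ 2) $ 1 = 0"
    by (simp_all add: s algebra_simps)
  have 3: "(B ^ 3) $ 3 = (B $ 1) ^ 3"
    by (simp add: s algebra_simps)
  have sets: "{0..1::nat} = {0,1}" "{0..2::nat} = {0,1,2}" "{0..3::nat} = {0,1,2,3}" by auto
  show "(A oo B) $ 1 = A $ 1 * B $ 1"
    by (simp add: fps_compose_nth)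
  show "(A oo B) $ 2 = A $ 1 * B $ 2 + A $ 2 * (B $ 1)\<^sup>2"
    by (simp add: fps_compose_nth sets 2)
  show "(A oo B) $ 3 = A $ 1 * B $ 3 + 2 * A $ 2 * B $ 1 * B $ 2 + A $ 3 * (B $ 1) ^ 3"
    by (simp add: fps_compose_nth sets 2 3)
qed

lemma has_real_derivative_norm:
  fixes a :: "real \<Rightarrow> complex"
  assumes "(a has_vector_derivative b) (at s)" "a s \<noteq> 0"
  shows "((\<lambda>s. norm (a s)) has_real_derivative Re (cnj (a s) * b) / norm (a s)) (at s)"
proof -
  have "((\<lambda>s. norm (a s)) has_derivative (\<lambda>h. inner (h *\<^sub>R b) (sgn (a s)))) (at s)"
    using has_derivative_compose[OF assms(1)[unfolded has_vector_derivative_def]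
        has_derivative_norm[OF assms(2)]] .
  moreover have "inner (h *\<^sub>R b) (sgn (a s)) = Re (cnj (a s) * b) / norm (a s) * h" for h
    by (simp add: inner_complex_def sgn_eq algebra_simps add_divide_distrib)
  ultimately show ?thesis
    by (simp only: has_field_derivative_def)
qed

text \<open>For \<open>a = \<gamma>'\<close>, \<open>b = \<gamma>''\<close>,
  \<open>c = \<gamma>'''\<close> the numerator is the imaginary part of the Schwarzian derivative.
  The factor 3/2 arises because differentiating \<open>norm (a s) ^ 3\<close> gives
  \<open>3 * Re q * Im q\<close> with \<open>q = b s / a s\<close>, and
  \<open>Im (q\<^sup>2) = 2 * Re q * Im q\<close>.\<close>

lemma has_real_derivative_curvature:
  fixes a b :: "real \<Rightarrow> complex"
  assumes a: "(a has_vector_derivative b s) (at s)" and b: "(b has_vector_derivative c) (at s)"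
    and "a s \<noteq> 0"
  shows "((\<lambda>s. Im (cnj (a s) * b s) / norm (a s) ^ 3) has_real_derivative
           Im (c / a s - 3 / 2 * (b s / a s)\<^sup>2) / norm (a s)) (at s)"
proof -
  define n where "n = norm (a s)"
  have n: "n > 0" using assms by (simp add: n_def)
  have "((\<lambda>s. cnj (a s) * b s) has_vector_derivative cnj (a s) * c + cnj (b s) * b s) (at s)"
    by (intro has_vector_derivative_mult has_vector_derivative_cnj a b)
  then have "((\<lambda>s. Im (cnj (a s) * b s)) has_real_derivative Im (cnj (a s) * c + cnj (b s) * b s)) (at s)"
    by (simp only: has_vector_derivative_complex_iff)
  moreover have "((\<lambda>s. norm (a s) ^ 3) has_real_derivative
      3 * norm (a s) ^ 2 * (Re (cnj (a s) * b s) / norm (a s))) (at s)"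
    using DERIV_power[OF has_real_derivative_norm[OF a assms(3)], of 3] by (simp add: mult_ac)
  ultimately have D: "((\<lambda>s. Im (cnj (a s) * b s) / norm (a s) ^ 3) has_real_derivative
    (Im (cnj (a s) * c + cnj (b s) * b s) * n ^ 3 -
      Im (cnj (a s) * b s) * (3 * n ^ 2 * (Re (cnj (a s) * b s) / n))) / (n ^ 3 * n ^ 3)) (at s)"
    unfolding n_def by (rule DERIV_divide) (use assms in auto)
  define q u where "q = b s / a s" and "u = c / a s"
  have eq: "cnj (a s) * z = of_real (n\<^sup>2) * (z / a s)" for z
    using assms complex_norm_square[of "a s"] by (simp add: n_def)
  have re: "Re (of_real r * z) = r * Re z" "Im (of_real r * z) = r * Im z" for r z by simp_all
  have "Im (cnj (b s) * b s) = 0" by simp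
  then have 1: "Im (cnj (a s) * c + cnj (b s) * b s) = n\<^sup>2 * Im u"
    by (simp only: plus_complex.sel eq re u_def)
  have 2: "Im (cnj (a s) * b s) = n\<^sup>2 * Im q" "Re (cnj (a s) * b s) = n\<^sup>2 * Re q"
    by (simp_all only: eq re q_def)
  have "Im (u - 3 / 2 * q\<^sup>2) = Im u - 3 * (Re q * Im q)"
    by (simp add: power2_eq_square)
  moreover have "(n\<^sup>2 * U * n ^ 3 - n\<^sup>2 * I * (3 * n ^ 2 * (n\<^sup>2 * R / n))) / (n ^ 3 * n ^ 3) =
      (U - 3 * (R * I)) / n" for U R I
    using n by (simp add: field_simps power2_eq_square power3_eq_cube)
  ultimately show ?thesis
    using D unfolding 1 2 by (simp only: q_def u_def n_def)
qed

text \<open>In Taylor coefficients \<open>\<gamma>'' / \<gamma>'\<close> is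
  \<open>2 * G $ 2 / G $ 1\<close>, and the Schwarzian is 6 times
  \<open>G $ 3 / G $ 1 - (G $ 2 / G $ 1)\<^sup>2\<close>. Of the curve itself only one fact is kept:
  \<open>g\<close> sends small real numbers into \<open>\<Gamma>\<close>.\<close>

lemma local_param_expansion:
  assumes "local_param \<Gamma> p \<gamma>"
  obtains g G where "(\<lambda>z. g z - p) has_fps_expansion G" "G $ 0 = 0" "G $ 1 \<noteq> 0"
    "\<forall>\<^sub>F s in nhds (0::real). g (of_real s) \<in> \<Gamma>" "velocity \<gamma> 0 = G $ 1"
    "signed_curvature \<gamma> 0 = 2 * Im (G $ 2 / G $ 1) / norm (G $ 1)"
    "arclength_deriv \<gamma> (signed_curvature \<gamma>) 0 =
       6 * Im (G $ 3 / G $ 1 - (G $ 2 / G $ 1)\<^sup>2) / (norm (G $ 1))\<^sup>2"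
proof -
  from assms obtain \<epsilon> g where \<epsilon>: "\<epsilon> > 0" and g: "g holomorphic_on ball 0 \<epsilon>" "inj_on g (ball 0 \<epsilon>)" "g 0 = p"
    and \<gamma>: "\<And>s. \<bar>s\<bar> < \<epsilon> \<Longrightarrow> \<gamma> s = g (of_real s)" and \<Gamma>: "\<Gamma> \<inter> g ` ball 0 \<epsilon> = \<gamma> ` {-\<epsilon><..<\<epsilon>}"
    unfolding local_param_def by auto
  define G where "G = fps_expansion (\<lambda>z. g z - p) 0"
  have G: "(\<lambda>z. g z - p) has_fps_expansion G"
    unfolding G_def by (rule has_fps_expansion_fps_expansion[of "ball 0 \<epsilon>"])
      (use \<epsilon> g in \<open>auto intro!: holomorphic_intros\<close>)
  have "g has_fps_expansion fps_const p + G"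
    using has_fps_expansion_add[OF has_fps_expansion_const[of p] G] by simp
  from fps_nth_fps_expansion[OF this] have Gs: "(deriv ^^ Suc n) g 0 = fact (Suc n) * G $ Suc n" for n
    by (metis fps_add_nth fps_nth_fps_const add_0 nonzero_mult_div_cancel_left fact_nonzero
      times_divide_eq_right nat.distinct(1))
  have g1: "deriv g 0 = G $ 1" and g2: "deriv (deriv g) 0 = 2 * G $ 2"
    and g3: "deriv (deriv (deriv g)) 0 = 6 * G $ 3"
    using Gs[of 0] Gs[of 1] Gs[of 2] by (simp_all add: numeral_2_eq_2 numeral_3_eq_3)
  have vd: "((\<lambda>s. f (of_real s)) has_vector_derivative deriv f (of_real s)) (at s)"
    if "f holomorphic_on ball 0 \<epsilon>" "\<bar>s\<bar> < \<epsilon>" for f s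
    using has_vector_derivative_real_field[OF holomorphic_derivI[OF that(1), of "of_real s"]] that
    by auto
  have near: "\<forall>\<^sub>F s' in nhds s. \<bar>s'\<bar> < \<epsilon>" if "\<bar>s\<bar> < \<epsilon>" for s
    using that eventually_nhds_in_open[of "{-\<epsilon><..<\<epsilon>}" s] by (auto elim!: eventually_mono simp: abs_less_iff)
  \<comment> \<open>Stated for general \<open>c\<close> and \<open>f\<close> in order to be applied
    twice, to \<open>\<gamma>\<close> with \<open>g\<close> and then to
    \<open>velocity \<gamma>\<close> with \<open>deriv g\<close>.\<close>
  have vel: "velocity c s = deriv f (of_real s)"
    if "f holomorphic_on ball 0 \<epsilon>" "\<bar>s\<bar> < \<epsilon>" "\<And>s. \<bar>s\<bar> < \<epsilon> \<Longrightarrow> c s = f (of_real s)" for c f s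
    unfolding velocity_def
    by (rule vector_derivative_at, rule has_vector_derivative_transform_within_open[OF vd[OF that(1,2)], of "{-\<epsilon><..<\<epsilon>}"])
      (use that in auto)
  have h1: "deriv g holomorphic_on ball 0 \<epsilon>" and h2: "deriv (deriv g) holomorphic_on ball 0 \<epsilon>"
    using g by (auto intro!: holomorphic_intros)
  note v1 = vel[OF g(1) _ \<gamma>]
  note v2 = vel[OF h1 _ v1]
  have k: "signed_curvature \<gamma> s = Im (cnj (deriv g (of_real s)) * deriv (deriv g) (of_real s)) / norm (deriv g (of_real s)) ^ 3"
    if "\<bar>s\<bar> < \<epsilon>" for s
    using v1[OF that] v2[OF that] by (simp add: signed_curvature_def)
  have nz: "G $ 1 \<noteq> 0"
    unfolding g1[symmetric] using holomorphic_injective_imp_regular[OF g(1) _ g(2)] \<epsilon> by auto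
  have "((\<lambda>s. Im (cnj (deriv g (of_real s)) * deriv (deriv g) (of_real s)) / norm (deriv g (of_real s)) ^ 3)
     has_real_derivative Im (deriv (deriv (deriv g)) (of_real 0) / deriv g (of_real 0) -
       3 / 2 * (deriv (deriv g) (of_real 0) / deriv g (of_real 0))\<^sup>2) / norm (deriv g (of_real 0))) (at 0)"
    by (rule has_real_derivative_curvature) (use vd[OF h1, of 0] vd[OF h2, of 0] \<epsilon> nz g1 in auto)
  then have "(signed_curvature \<gamma> has_real_derivative Im (6 * G $ 3 / G $ 1 -
       3 / 2 * (2 * G $ 2 / G $ 1)\<^sup>2) / norm (G $ 1)) (at 0)"
    unfolding of_real_0 g1 g2 g3
    by (rule has_field_derivative_transform_within_open[of _ _ _ "{-\<epsilon><..<\<epsilon>}"]) (use \<epsilon> k in auto)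
  moreover have "Im (6 * G $ 3 / G $ 1 - 3 / 2 * (2 * G $ 2 / G $ 1)\<^sup>2) =
      6 * Im (G $ 3 / G $ 1 - (G $ 2 / G $ 1)\<^sup>2)"
  proof -
    have "6 * G $ 3 / G $ 1 - 3 / 2 * (2 * G $ 2 / G $ 1)\<^sup>2 =
        of_real 6 * (G $ 3 / G $ 1 - (G $ 2 / G $ 1)\<^sup>2)"
      by (simp add: power2_eq_square algebra_simps)
    moreover have "Im (of_real 6 * z) = 6 * Im z" for z by simp
    ultimately show ?thesis by metis
  qed
  ultimately have "deriv (signed_curvature \<gamma>) 0 =
      6 * Im (G $ 3 / G $ 1 - (G $ 2 / G $ 1)\<^sup>2) / norm (G $ 1)"
    using DERIV_imp_deriv by metis
  then have "arclength_deriv \<gamma> (signed_curvature \<gamma>) 0 =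
       6 * Im (G $ 3 / G $ 1 - (G $ 2 / G $ 1)\<^sup>2) / (norm (G $ 1))\<^sup>2"
    using v1[of 0] \<epsilon> g1 by (simp add: arclength_deriv_def power2_eq_square)
  moreover have "signed_curvature \<gamma> 0 = 2 * Im (G $ 2 / G $ 1) / norm (G $ 1)"
  proof -
    have "cnj (G $ 1) * (2 * G $ 2) = of_real (2 * (norm (G $ 1))\<^sup>2) * (G $ 2 / G $ 1)"
      using nz complex_norm_square[of "G $ 1"] by simp
    moreover have "Im (of_real r * z) = r * Im z" for r z by simp
    moreover have "signed_curvature \<gamma> 0 = Im (cnj (G $ 1) * (2 * G $ 2)) / norm (G $ 1) ^ 3"
      using k[of 0] \<epsilon> by (simp only: of_real_0 g1 g2 abs_zero)
    ultimately have "signed_curvature \<gamma> 0 = 2 * (norm (G $ 1))\<^sup>2 * Im (G $ 2 / G $ 1) / norm (G $ 1) ^ 3"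
      by metis
    then show ?thesis
      using nz by (simp add: power2_eq_square power3_eq_cube)
  qed
  moreover have "\<forall>\<^sub>F s in nhds (0::real). g (of_real s) \<in> \<Gamma>"
  proof -
    have "g (of_real s) \<in> \<Gamma>" if "\<bar>s\<bar> < \<epsilon>" for s
    proof -
      have "\<gamma> s \<in> \<gamma> ` {-\<epsilon><..<\<epsilon>}" using that by (intro imageI) (simp add: abs_less_iff)
      then show ?thesis using \<Gamma> \<gamma>[OF that] by auto
    qed
    then show ?thesis using near[of 0] \<epsilon> by (auto elim!: eventually_mono)
  qed
  moreover have "G $ 0 = 0" using fps_nth_fps_expansion[OF G, of 0] g by simp
  ultimately show ?thesis using that G nz v1[of 0] \<epsilon> g1 by simp
qed

text \<open>Pulling a parametrization of the image curve back by the inverse of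
  \<open>\<phi>\<close> gives one of \<open>\<Gamma>\<close> itself, with series \<open>F\<close>.
  There the Schwarz function yields \<open>fps_cnj F = \<sigma> oo F\<close>, while
  \<open>\<phi>\<close> enters only through \<open>\<Phi> oo F\<close>.\<close>

lemma local_param_image_jet:
  assumes N: "open N" "p \<in> N" "\<phi> holomorphic_on N" "inj_on \<phi> N"
    and \<gamma>: "local_param (\<phi> ` (\<Gamma> \<inter> N)) (\<phi> p) \<gamma>"
    and \<Phi>: "(\<lambda>z. \<phi> (p + z) - \<phi> p) has_fps_expansion \<Phi>"
    and \<Gamma>: "\<And>z. z \<in> \<Gamma> \<Longrightarrow> cnj z = S z"
    and \<sigma>: "(\<lambda>z. S (p + z) - cnj p) has_fps_expansion \<sigma>"
  obtains F where "F $ 0 = 0" "F $ 1 \<noteq> 0" "fps_cnj F = \<sigma> oo F"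
    "velocity \<gamma> 0 = (\<Phi> oo F) $ 1"
    "signed_curvature \<gamma> 0 = 2 * Im ((\<Phi> oo F) $ 2 / (\<Phi> oo F) $ 1) / norm ((\<Phi> oo F) $ 1)"
    "arclength_deriv \<gamma> (signed_curvature \<gamma>) 0 =
       6 * Im ((\<Phi> oo F) $ 3 / (\<Phi> oo F) $ 1 - ((\<Phi> oo F) $ 2 / (\<Phi> oo F) $ 1)\<^sup>2) / (norm ((\<Phi> oo F) $ 1))\<^sup>2"
proof -
  from local_param_expansion[OF \<gamma>] obtain g G where
    G: "(\<lambda>z. g z - \<phi> p) has_fps_expansion G" "G $ 0 = 0" "G $ 1 \<noteq> 0"
    and gs: "\<forall>\<^sub>F s in nhds (0::real). g (of_real s) \<in> \<phi> ` (\<Gamma> \<inter> N)" and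
    vel: "velocity \<gamma> 0 = G $ 1"
    "signed_curvature \<gamma> 0 = 2 * Im (G $ 2 / G $ 1) / norm (G $ 1)"
    "arclength_deriv \<gamma> (signed_curvature \<gamma>) 0 =
       6 * Im (G $ 3 / G $ 1 - (G $ 2 / G $ 1)\<^sup>2) / (norm (G $ 1))\<^sup>2" .
  from holomorphic_has_inverse[OF N(3,1,4)] obtain \<psi> where
    \<psi>: "\<psi> holomorphic_on \<phi> ` N" "\<And>z. z \<in> N \<Longrightarrow> \<psi> (\<phi> z) = z" by metis
  have op: "open (\<phi> ` N)" by (rule open_mapping_thm3[OF N(3,1,4)])
  define \<Psi> where "\<Psi> = fps_expansion (\<lambda>w. \<psi> (\<phi> p + w) - p) 0"
  have \<Psi>: "(\<lambda>w. \<psi> (\<phi> p + w) - p) has_fps_expansion \<Psi>"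
    unfolding \<Psi>_def
  proof (rule has_fps_expansion_fps_expansion)
    show "open ((\<lambda>w. \<phi> p + w) -` (\<phi> ` N))"
      by (intro open_vimage op continuous_intros)
    show "(\<lambda>w. \<psi> (\<phi> p + w) - p) holomorphic_on (\<lambda>w. \<phi> p + w) -` (\<phi> ` N)"
      by (intro holomorphic_intros holomorphic_on_compose_gen[OF _ \<psi>(1), unfolded o_def]) auto
  qed (use N in auto)
  define f where "f z = \<psi> (g z) - p" for z
  define F where "F = \<Psi> oo G"
  have F: "f has_fps_expansion F"
    using has_fps_expansion_compose[OF \<Psi> G(1,2)] by (simp add: o_def f_def[abs_def] F_def)
  have "\<Psi> $ 0 = 0" using fps_nth_fps_expansion[OF \<Psi>, of 0] \<psi>(2) N by simp
  then have F0: "F $ 0 = 0" by (simp add: F_def)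
  have "\<Phi> oo F = G"
  proof (rule fps_expansion_unique_on_reals[OF has_fps_expansion_compose[OF \<Phi> F F0] G(1)])
    show "\<forall>\<^sub>F s in nhds 0. ((\<lambda>z. \<phi> (p + z) - \<phi> p) \<circ> f) (complex_of_real s) = g (complex_of_real s) - \<phi> p"
      using gs by eventually_elim (auto simp: f_def \<psi>)
  qed
  \<comment> \<open>At real arguments \<open>f\<close> is a point of \<open>\<Gamma>\<close> shifted
    by \<open>p\<close>, where conjugation agrees with \<open>S\<close>; both sides are holomorphic,
    so the series agree.\<close>
  moreover have "fps_cnj F = \<sigma> oo F"
  proof (rule fps_expansion_unique_on_reals[OF has_fps_expansion_cnj[OF F] has_fps_expansion_compose[OF \<sigma> F F0]])
    show "\<forall>\<^sub>F s in nhds 0. cnj (f (cnj (complex_of_real s))) = ((\<lambda>z. S (p + z) - cnj p) \<circ> f) (complex_of_real s)"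
      using gs by eventually_elim (auto simp: f_def \<psi> dest: \<Gamma>)
  qed
  moreover have "F $ 1 \<noteq> 0"
    using G(3) fps_compose_nth_1_2_3(1)[OF F0, of \<Phi>] \<open>\<Phi> oo F = G\<close> by auto
  ultimately show ?thesis using that F0 vel by simp
qed

text \<open>Near a fixed point the antiholomorphic involution \<open>z \<mapsto> cnj (S z)\<close>
  is conjugate to complex conjugation, so its fixed points form an analytic arc. The involution
  property \<open>refl\<close> is essential: for \<open>S z = z + \<i> * z\<^sup>2\<close> the
  solution set near 0 is the single point 0.\<close>

lemma schwarz_local_param_image:
  assumes N: "open N" "p \<in> N" "\<phi> holomorphic_on N" "inj_on \<phi> N"
    and V: "open V" "p \<in> V" "S holomorphic_on V"
    and refl: "\<forall>\<^sub>F z in nhds p. S (cnj (S z)) = cnj z"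
    and S: "S p = cnj p" "deriv S p = cis (- 2 * \<alpha>)"
  obtains \<gamma> where "local_param (\<phi> ` ({z\<in>V. cnj z = S z} \<inter> N)) (\<phi> p) \<gamma>"
    "velocity \<gamma> 0 = deriv \<phi> p * cis \<alpha>"
proof -
  \<comment> \<open>\<open>h\<close> flattens the curve: it averages \<open>e\<^sup>-\<^sup>i\<^sup>\<alpha> (z - p)\<close> with its reflection, so \<open>h (cnj (S z)) = cnj (h z)\<close>.\<close>
  define h where "h z = (cis (- \<alpha>) * (z - p) + cis \<alpha> * (S z - cnj p)) / 2" for z
  have holV: "h holomorphic_on V"
    unfolding h_def by (intro holomorphic_intros V(3)) auto
  have "(h has_field_derivative (cis (- \<alpha>) * 1 + cis \<alpha> * cis (- 2 * \<alpha>)) / 2) (at p)"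
    using holomorphic_derivI[OF V(3,1,2), of UNIV] unfolding h_def S(2)
    by (auto intro!: derivative_eq_intros)
  \<comment> \<open>Both summands have derivative \<open>cis (- \<alpha>)\<close>, so
    \<open>h\<close> turns the direction \<open>cis \<alpha>\<close> into the real
    direction.\<close>
  then have dh: "(h has_field_derivative cis (- \<alpha>)) (at p)"
    by (simp add: cis_mult)
  obtain r0 where r0: "r0 > 0" "ball p r0 \<subseteq> V \<inter> N" "inj_on h (ball p r0)"
    using has_complex_derivative_locally_injective[of h "V \<inter> N" p] N V DERIV_imp_deriv[OF dh] holV
    by (metis IntI cis_neq_zero holomorphic_on_subset inf_le1 open_Int)
  have "isCont (\<lambda>z. cnj (S z)) p"
    using holomorphic_on_imp_continuous_on[OF V(3)] V(1,2)
    by (intro continuous_intros) (simp add: continuous_on_eq_continuous_at)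
  then have "((\<lambda>z. cnj (S z)) \<longlongrightarrow> p) (at p)"
    using S by (simp add: isCont_def)
  then have "\<forall>\<^sub>F z in at p. cnj (S z) \<in> ball p r0"
    by (rule topological_tendstoD) (use r0 in auto)
  then have "\<forall>\<^sub>F z in nhds p. cnj (S z) \<in> ball p r0"
    using r0 S by (simp add: eventually_nhds_conv_at)
  \<comment> \<open>Two radii are needed: \<open>h\<close> is injective on the ball of radius
    \<open>r0\<close>, and for \<open>z\<close> within \<open>r1\<close> of \<open>p\<close> the
    reflected point \<open>cnj (S z)\<close> still lies in that ball.\<close>
  with refl have "\<forall>\<^sub>F z in nhds p. S (cnj (S z)) = cnj z \<and> cnj (S z) \<in> ball p r0"
    by (rule eventually_conj)
  then obtain r1 where r1: "r1 > 0"
    "\<And>z. dist z p < r1 \<Longrightarrow> S (cnj (S z)) = cnj z \<and> cnj (S z) \<in> ball p r0"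
    unfolding eventually_nhds_metric by blast
  define r where "r = min r0 r1"
  have r: "r > 0" "ball p r \<subseteq> ball p r0" using r0 r1 by (auto simp: r_def)
  have hol: "h holomorphic_on ball p r0" "h holomorphic_on ball p r"
    using r0 r holV by (blast intro: holomorphic_on_subset)+
  have inj: "inj_on h (ball p r)" using r0(3) r(2) by (rule inj_on_subset)
  have op: "open (h ` ball p r)" by (rule open_mapping_thm3[OF hol(2) _ inj]) auto
  have hp: "h p = 0" by (simp add: h_def S)
  then have "0 \<in> h ` ball p r" using r by (metis centre_in_ball image_eqI)
  then obtain \<epsilon> where \<epsilon>: "\<epsilon> > 0" "ball 0 \<epsilon> \<subseteq> h ` ball p r" using op openE by metis
  from holomorphic_has_inverse[OF hol(2) _ inj] obtain k where
    k: "k holomorphic_on h ` ball p r" "\<And>z. z \<in> ball p r \<Longrightarrow> deriv h z * deriv k (h z) = 1"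
    "\<And>z. z \<in> ball p r \<Longrightarrow> k (h z) = z" by auto
  have k2: "k w \<in> ball p r" "h (k w) = w" if w: "w \<in> ball 0 \<epsilon>" for w
  proof -
    obtain z where z: "z \<in> ball p r" "w = h z" using w \<epsilon>(2) by blast
    then show "k w \<in> ball p r" "h (k w) = w" using k(3)[OF z(1)] by simp_all
  qed
  have sub: "ball p r \<subseteq> V" "ball p r \<subseteq> N" using r r0 by auto
  define g where "g = \<phi> \<circ> k"
  have holk: "k holomorphic_on ball 0 \<epsilon>" using k(1) \<epsilon>(2) by (rule holomorphic_on_subset)
  have kimg: "k ` ball 0 \<epsilon> \<subseteq> N" using k2 sub by blast
  have holg: "g holomorphic_on ball 0 \<epsilon>"
    unfolding g_def by (rule holomorphic_on_compose_gen[OF holk N(3) kimg])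
  have k0: "k 0 = p" using k(3)[of p] hp r by simp
  define \<gamma> where "\<gamma> s = g (of_real s)" for s
  have "inj_on g (ball 0 \<epsilon>)"
    unfolding g_def
  proof (rule comp_inj_on)
    show "inj_on k (ball 0 \<epsilon>)" using k2 by (metis inj_onI)
    show "inj_on \<phi> (k ` ball 0 \<epsilon>)" by (rule inj_on_subset[OF N(4) kimg])
  qed
  moreover have "\<phi> ` ({z\<in>V. cnj z = S z} \<inter> N) \<inter> g ` ball 0 \<epsilon> = \<gamma> ` {-\<epsilon><..<\<epsilon>}"
  proof (intro equalityI subsetI)
    fix y assume "y \<in> \<phi> ` ({z\<in>V. cnj z = S z} \<inter> N) \<inter> g ` ball 0 \<epsilon>"
    then obtain z w where z: "y = \<phi> z" "z \<in> N" "cnj z = S z" and w: "y = \<phi> (k w)" "w \<in> ball 0 \<epsilon>"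
      unfolding g_def o_def by blast
    then have "z = k w" using N(4) k2(1)[OF w(2)] sub by (auto dest: inj_onD)
    then have "w = h z" using k2 w by simp
    define u where "u = cis (- \<alpha>) * (z - p)"
    \<comment> \<open>On the curve the second summand of \<open>h\<close> is the conjugate of the
      first, so \<open>h\<close> is real there.\<close>
    have "h z = (u + cnj u) / 2" by (simp add: h_def u_def z(3) cis_cnj)
    then have "w = of_real (Re u)" using \<open>w = h z\<close> by (simp add: complex_add_cnj)
    then show "y \<in> \<gamma> ` {-\<epsilon><..<\<epsilon>}"
      using w by (intro image_eqI[of _ _ "Re u"]) (auto simp: \<gamma>_def g_def abs_less_iff)
  next
    fix y assume "y \<in> \<gamma> ` {-\<epsilon><..<\<epsilon>}"
    then obtain s where s: "y = g (of_real s)" "\<bar>s\<bar> < \<epsilon>" by (auto simp: \<gamma>_def abs_less_iff)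
    then have sb: "complex_of_real s \<in> ball 0 \<epsilon>" by simp
    define z where "z = k (of_real s)"
    have z: "z \<in> ball p r" "h z = of_real s" using k2[OF sb] by (auto simp: z_def)
    then have "dist z p < r1" by (simp add: r_def dist_commute)
    from r1(2)[OF this] have z2: "S (cnj (S z)) = cnj z" "cnj (S z) \<in> ball p r0" by auto
    \<comment> \<open>Conversely, where \<open>h\<close> is real a point and its reflection have the
      same image under \<open>h\<close>; injectivity then makes the point fixed, that is, a point of
      the curve.\<close>
    have "h (cnj (S z)) = cnj (h z)" by (simp add: h_def z2(1) cis_cnj add.commute)
    then have "h (cnj (S z)) = h z" using z(2) by simp
    then have "cnj (S z) = z" using inj_onD[OF r0(3) _ z2(2)] z(1) r(2) by blast
    then have "cnj z = S z" by (metis complex_cnj_cnj)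
    moreover have "z \<in> V" "z \<in> N" using z(1) sub by auto
    moreover have "y = \<phi> z" by (simp add: s g_def z_def)
    ultimately show "y \<in> \<phi> ` ({z\<in>V. cnj z = S z} \<inter> N) \<inter> g ` ball 0 \<epsilon>"
      using s(1) sb by blast
  qed
  moreover have "g 0 = \<phi> p" by (simp add: g_def k0)
  ultimately have "local_param (\<phi> ` ({z\<in>V. cnj z = S z} \<inter> N)) (\<phi> p) \<gamma>"
    unfolding local_param_def using \<epsilon>(1) holg
    by (intro exI[of _ \<epsilon>] exI[of _ g] conjI) (auto simp only: \<gamma>_def)
  moreover have "velocity \<gamma> 0 = deriv \<phi> p * cis \<alpha>"
  proof -
    have "deriv h p * deriv k 0 = 1" using k(2)[of p] r hp by simp
    then have "cis (- \<alpha>) * deriv k 0 = 1" using DERIV_imp_deriv[OF dh] by simp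
    moreover have "cis \<alpha> * cis (- \<alpha>) = 1" by (simp add: cis_mult)
    ultimately have "deriv k 0 = cis \<alpha>" by (metis mult.left_commute mult.right_neutral)
    moreover have "(k has_field_derivative deriv k 0) (at 0)"
      using holk \<epsilon> by (intro holomorphic_derivI) auto
    moreover have "(\<phi> has_field_derivative deriv \<phi> p) (at (k 0))"
      using N k0 by (auto intro: holomorphic_derivI)
    ultimately have "(g has_field_derivative deriv \<phi> p * cis \<alpha>) (at (of_real 0))"
      unfolding g_def using DERIV_chain[of \<phi> "deriv \<phi> p" k 0 "deriv k 0" UNIV] by simp
    then show ?thesis
      unfolding velocity_def \<gamma>_def[abs_def]
      by (intro vector_derivative_at has_vector_derivative_real_field)
  qed
  ultimately show ?thesis using that by blast
qed

lemma schwarz_jet_direction: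
  assumes "F $ 0 = 0" "F $ 1 \<noteq> 0" "fps_cnj F = \<sigma> oo F"
  shows "cnj (F $ 1) = \<sigma> $ 1 * F $ 1"
  by (metis assms fps_cnj_nth fps_compose_nth_1_2_3(1))

text \<open>For \<open>\<Phi> = fps_X\<close> this reads: curvature \<open>a\<close> up to
  orientation, and arclength derivative \<open>3 * b\<close>. The summand
  \<open>(\<sigma> $ 2)\<^sup>2 = - a\<^sup>2\<close> is the real part that
  \<open>\<sigma> $ 3\<close> must have for a reflection. Reversing the direction,
  \<open>Re (F $ 1) < 0\<close>, changes the sign of the curvature but not of its arclength
  derivative.\<close>

lemma image_jet_curvature:
  assumes F: "F $ 0 = 0" "F $ 1 \<noteq> 0" "fps_cnj F = \<sigma> oo F"
    and \<sigma>: "\<sigma> $ 1 = 1" "\<sigma> $ 2 = - \<i> * of_real a" "\<sigma> $ 3 = - \<i> * of_real b + (\<sigma> $ 2)\<^sup>2"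
    and \<Phi>: "\<Phi> $ 1 \<noteq> 0"
  shows "Im (F $ 1) = 0"
    and "(\<Phi> oo F) $ 1 = \<Phi> $ 1 * of_real (Re (F $ 1))"
    and "2 * Im ((\<Phi> oo F) $ 2 / (\<Phi> oo F) $ 1) / norm ((\<Phi> oo F) $ 1) =
           sgn (Re (F $ 1)) * (a + 2 * Im (\<Phi> $ 2 / \<Phi> $ 1)) / norm (\<Phi> $ 1)"
    and "6 * Im ((\<Phi> oo F) $ 3 / (\<Phi> oo F) $ 1 - ((\<Phi> oo F) $ 2 / (\<Phi> oo F) $ 1)\<^sup>2) / (norm ((\<Phi> oo F) $ 1))\<^sup>2 =
           (3 * b + 6 * Im (\<Phi> $ 3 / \<Phi> $ 1 - (\<Phi> $ 2 / \<Phi> $ 1)\<^sup>2)) / (norm (\<Phi> $ 1))\<^sup>2"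
proof -
  define x where "x = Re (F $ 1)"
  note c = fps_compose_nth_1_2_3[OF F(1)]
  have cnj: "cnj (F $ n) = (\<sigma> oo F) $ n" for n
    by (metis F(3) fps_cnj_nth)
  have "cnj (F $ 1) = F $ 1" using cnj[of 1] c(1)[of \<sigma>] \<sigma> by simp
  then show im: "Im (F $ 1) = 0" by (simp add: complex_eq_iff)
  then have F1: "F $ 1 = of_real x" by (simp add: x_def complex_eq_iff)
  have x: "x \<noteq> 0" using F(2) F1 by auto
  show G1: "(\<Phi> oo F) $ 1 = \<Phi> $ 1 * of_real (Re (F $ 1))"
    using c(1)[of \<Phi>] F1 x_def by simp
  \<comment> \<open>The reflection relation fixes only imaginary parts of coefficients; the real
    parts depend on the choice of parametrization.\<close>
  have F2: "Im (F $ 2) = a * x\<^sup>2 / 2"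
  proof -
    have "cnj (F $ 2) = F $ 2 - \<i> * of_real a * (of_real x)\<^sup>2"
      using cnj[of 2] c(2)[of \<sigma>] \<sigma> F1 by simp
    from arg_cong[OF this, of Im] show ?thesis by (simp flip: of_real_power)
  qed
  have F3: "Im (F $ 3) = a * x * Re (F $ 2) + b * x ^ 3 / 2"
  proof -
    have "cnj (F $ 3) = F $ 3 + 2 * (- \<i> * of_real a) * of_real x * F $ 2 +
        (- \<i> * of_real b + (- \<i> * of_real a)\<^sup>2) * (of_real x) ^ 3"
      using cnj[of 3] c(3)[of \<sigma>] \<sigma> F1 by simp
    then have "cnj (F $ 3) = F $ 3 - 2 * \<i> * (of_real (a * x) * F $ 2) - \<i> * of_real (b * x ^ 3) - of_real (a\<^sup>2 * x ^ 3)"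
      by (simp add: power_mult_distrib algebra_simps)
    from arg_cong[OF this, of Im] show ?thesis by simp
  qed
  have nG: "norm ((\<Phi> oo F) $ 1) = norm (\<Phi> $ 1) * \<bar>x\<bar>" by (simp only: G1[folded x_def] norm_mult norm_of_real)
  \<comment> \<open>The chain rule for the quotient of second by first derivative, up to a factor
    2.\<close>
  have q2: "(\<Phi> oo F) $ 2 / (\<Phi> oo F) $ 1 = F $ 2 / of_real x + (\<Phi> $ 2 / \<Phi> $ 1) * of_real x"
    using c[of \<Phi>] F1 x \<Phi> by (simp add: field_simps power2_eq_square)
  have "Im ((\<Phi> oo F) $ 2 / (\<Phi> oo F) $ 1) = x / 2 * (a + 2 * Im (\<Phi> $ 2 / \<Phi> $ 1))"
  proof -
    have "Im (z * of_real x) = Im z * x" for z by simp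
    then have "Im ((\<Phi> oo F) $ 2 / (\<Phi> oo F) $ 1) = a * x\<^sup>2 / 2 / x + Im (\<Phi> $ 2 / \<Phi> $ 1) * x"
      by (simp only: q2 plus_complex.sel Im_divide_of_real F2)
    then show ?thesis
      using x by (simp add: algebra_simps power2_eq_square)
  qed
  note A = this
  have "2 * Im ((\<Phi> oo F) $ 2 / (\<Phi> oo F) $ 1) / norm ((\<Phi> oo F) $ 1) =
     sgn x * (a + 2 * Im (\<Phi> $ 2 / \<Phi> $ 1)) / norm (\<Phi> $ 1)"
    unfolding nG A real_sgn_eq by simp
  then show "2 * Im ((\<Phi> oo F) $ 2 / (\<Phi> oo F) $ 1) / norm ((\<Phi> oo F) $ 1) =
           sgn (Re (F $ 1)) * (a + 2 * Im (\<Phi> $ 2 / \<Phi> $ 1)) / norm (\<Phi> $ 1)"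
    by (simp only: x_def)
  \<comment> \<open>The chain rule for the Schwarzian, up to a factor 6: the mixed terms cancel, and
    the Schwarzian of \<open>\<Phi>\<close> enters with the weight \<open>x\<^sup>2\<close>.\<close>
  have q3: "(\<Phi> oo F) $ 3 / (\<Phi> oo F) $ 1 - ((\<Phi> oo F) $ 2 / (\<Phi> oo F) $ 1)\<^sup>2 =
      (F $ 3 / of_real x - (F $ 2 / of_real x)\<^sup>2) + of_real (x\<^sup>2) * (\<Phi> $ 3 / \<Phi> $ 1 - (\<Phi> $ 2 / \<Phi> $ 1)\<^sup>2)"
  proof -
    have m: "F $ 2 = F $ 2 / of_real x * of_real x" using x by simp
    have "(\<Phi> oo F) $ 3 / (\<Phi> oo F) $ 1 =
        F $ 3 / of_real x + 2 * (\<Phi> $ 2 / \<Phi> $ 1) * F $ 2 + \<Phi> $ 3 / \<Phi> $ 1 * (of_real x)\<^sup>2"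
      using c[of \<Phi>] F1 x \<Phi> by (simp add: add_divide_distrib power2_eq_square power3_eq_cube)
    also have "2 * (\<Phi> $ 2 / \<Phi> $ 1) * F $ 2 = 2 * (\<Phi> $ 2 / \<Phi> $ 1) * (F $ 2 / of_real x * of_real x)"
      by (simp only: m[symmetric])
    finally show ?thesis
      unfolding q2 by (simp only: power2_eq_square of_real_mult ring_distribs) (simp add: mult_ac)
  qed
  have "Im ((F $ 2)\<^sup>2) = 2 * Re (F $ 2) * Im (F $ 2)" by (simp add: power2_eq_square)
  then have "Im ((F $ 2 / of_real x)\<^sup>2) = 2 * Re (F $ 2) * (a * x\<^sup>2 / 2) / x\<^sup>2"
    unfolding power_divide F2 of_real_power[symmetric] Im_divide_of_real by simp
  \<comment> \<open>The summand \<open>a * Re (F $ 2)\<close> occurs in both terms and cancels,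
    which removes the dependence on the parametrization.\<close>
  then have "Im (F $ 3 / of_real x - (F $ 2 / of_real x)\<^sup>2) = b * x\<^sup>2 / 2"
    using F3 F2 x by (simp add: field_simps power2_eq_square power3_eq_cube)
  moreover define W where "W = Im (\<Phi> $ 3 / \<Phi> $ 1 - (\<Phi> $ 2 / \<Phi> $ 1)\<^sup>2)"
  moreover have "Im (of_real (x\<^sup>2) * z) = x\<^sup>2 * Im z" for z by simp
  ultimately have "Im ((\<Phi> oo F) $ 3 / (\<Phi> oo F) $ 1 - ((\<Phi> oo F) $ 2 / (\<Phi> oo F) $ 1)\<^sup>2) =
      b * x\<^sup>2 / 2 + x\<^sup>2 * W"
    by (simp only: q3 plus_complex.sel)
  also have "\<dots> = x\<^sup>2 / 6 * (3 * b + 6 * W)"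
    by (simp add: algebra_simps)
  finally have B: "Im ((\<Phi> oo F) $ 3 / (\<Phi> oo F) $ 1 - ((\<Phi> oo F) $ 2 / (\<Phi> oo F) $ 1)\<^sup>2) =
      x\<^sup>2 / 6 * (3 * b + 6 * W)" .
  show "6 * Im ((\<Phi> oo F) $ 3 / (\<Phi> oo F) $ 1 - ((\<Phi> oo F) $ 2 / (\<Phi> oo F) $ 1)\<^sup>2) / (norm ((\<Phi> oo F) $ 1))\<^sup>2 =
           (3 * b + 6 * Im (\<Phi> $ 3 / \<Phi> $ 1 - (\<Phi> $ 2 / \<Phi> $ 1)\<^sup>2)) / (norm (\<Phi> $ 1))\<^sup>2"
    unfolding B nG W_def[symmetric] using x by (simp add: power_mult_distrib)
qed

section \<open>The reflection flow at a stationary point\<close>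

lemma fps_expansion_eqI_shift:
  assumes "f analytic_on {z}" "(\<lambda>x. f (z + x)) has_fps_expansion F"
  shows "fps_expansion f z = F"
  using analytic_at_imp_has_fps_expansion[OF assms(1)] assms(2) by (metis fps_expansion_eqI)

text \<open>Tangent angles are determined modulo \<open>pi\<close> only; this makes two continuous
  choices differ by a constant.\<close>

lemma continuous_integer_valued_const:
  fixes f :: "'a::topological_space \<Rightarrow> real"
  assumes "connected S" "continuous_on S f" "\<And>x. x \<in> S \<Longrightarrow> f x \<in> \<int>" "x \<in> S" "y \<in> S"
  shows "f x = f y"
proof -
  have "f constant_on S"
  proof (rule continuous_discrete_range_constant[OF assms(1,2)])
    fix x assume x: "x \<in> S"
    show "\<exists>e>0. \<forall>y. y \<in> S \<and> f y \<noteq> f x \<longrightarrow> e \<le> norm (f y - f x)"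
    proof (intro exI[of _ 1] conjI allI impI)
      fix y assume "y \<in> S \<and> f y \<noteq> f x"
      with assms(3) x have "f y - f x \<in> \<int>" "f y - f x \<noteq> 0" by auto
      then show "1 \<le> norm (f y - f x)" by (simp add: Ints_nonzero_abs_ge1)
    qed simp
  qed
  then show ?thesis using assms(4,5) by (auto simp: constant_on_def)
qed

locale reflection_flow =
  fixes v :: "complex \<Rightarrow> complex" and S :: "real \<Rightarrow> complex \<Rightarrow> complex"
    and U :: "complex set" and T :: "real set" and W :: "(real \<times> complex) set" and x\<^sub>0 :: real
  assumes open_U: "open U" and v_holo: "v holomorphic_on U"
    and v_real: "\<And>x::real. of_real x \<in> U \<Longrightarrow> v (of_real x) \<in> \<real>"
    and T_interval: "is_interval T" and T0: "0 \<in> T"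
    and W_open: "openin (top_of_set (T \<times> UNIV)) W" and W_sub: "W \<subseteq> T \<times> U"
    and S_cont: "continuous_on W (\<lambda>(t, z). S t z)"
    and S_holo: "\<And>t. t \<in> T \<Longrightarrow> S t holomorphic_on {z. (t, z) \<in> W}"
    and pde: "\<And>t z. (t, z) \<in> W \<Longrightarrow>
           ((\<lambda>\<tau>. S \<tau> z) has_vector_derivative - 2 * \<i> * v z * deriv (S t) z) (at t within T)"
    and S_init: "\<And>z. (0, z) \<in> W \<Longrightarrow> S 0 z = z"
    and v_x0: "v (of_real x\<^sub>0) = 0" and x0_W: "\<And>t. t \<in> T \<Longrightarrow> (t, of_real x\<^sub>0) \<in> W"
begin

abbreviation p :: complex where "p \<equiv> of_real x\<^sub>0"

definition V :: "complex fps" where "V = fps_expansion v p"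

text \<open>The Schwarz function in the coordinate centred at \<open>x\<^sub>0\<close>. Removing the
  constant \<open>p\<close> makes the series composable, and since \<open>p\<close> is real the
  shift commutes with conjugation.\<close>

definition s :: "real \<Rightarrow> complex fps" where "s t = fps_expansion (S t) p - fps_const p"

lemma convex_T: "convex T"
  using T_interval by (simp add: is_interval_convex)

lemma p_U: "p \<in> U"
  using x0_W[OF T0] W_sub by auto

lemma open_slice: "t \<in> T \<Longrightarrow> open {z. (t, z) \<in> W}"
proof -
  assume t: "t \<in> T"
  obtain W' where W': "open W'" "W = (T \<times> UNIV) \<inter> W'" using W_open by (metis openin_open)
  have "{z. (t, z) \<in> W} = Pair t -` W'" using t W'(2) by auto
  then show ?thesis using W'(1) by (simp add: open_vimage continuous_on_Pair)
qed

lemma S_analytic: "t \<in> T \<Longrightarrow> S t analytic_on {p}"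
  using S_holo open_slice x0_W by (auto simp: analytic_at)

lemma v_analytic: "v analytic_on {p}"
  using v_holo open_U p_U by (auto simp: analytic_at)

lemma V_expansion: "(\<lambda>z. v (p + z)) has_fps_expansion V"
  unfolding V_def by (rule analytic_at_imp_has_fps_expansion[OF v_analytic])

lemma S_expansion: "t \<in> T \<Longrightarrow> (\<lambda>z. S t (p + z)) has_fps_expansion fps_expansion (S t) p"
  by (rule analytic_at_imp_has_fps_expansion[OF S_analytic])

lemma s_expansion: "t \<in> T \<Longrightarrow> (\<lambda>z. S t (p + z) - p) has_fps_expansion s t"
  unfolding s_def by (intro has_fps_expansion_diff S_expansion has_fps_expansion_const)

lemma V_nth: "V $ n = (deriv ^^ n) v p / fact n"
  by (simp add: V_def fps_expansion_def)

lemma V_nth_0: "V $ 0 = 0"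
  by (simp add: V_nth v_x0)

text \<open>At real points near \<open>p\<close> the function \<open>v\<close> is real, so it agrees
  there with its Schwarz reflection.\<close>

lemma V_real: "fps_cnj V = V"
proof (rule fps_expansion_unique_on_reals[OF has_fps_expansion_cnj[OF V_expansion] V_expansion])
  have "isCont (\<lambda>s. complex_of_real (x\<^sub>0 + s)) 0" by (intro continuous_intros)
  then have "((\<lambda>s. complex_of_real (x\<^sub>0 + s)) \<longlongrightarrow> p) (at 0)" by (simp add: isCont_def)
  then have "\<forall>\<^sub>F s in at 0. complex_of_real (x\<^sub>0 + s) \<in> U"
    using open_U p_U by (rule topological_tendstoD)
  then have "\<forall>\<^sub>F s in nhds 0. complex_of_real (x\<^sub>0 + s) \<in> U"
    using p_U by (simp add: eventually_nhds_conv_at)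
  then show "\<forall>\<^sub>F s in nhds 0. cnj (v (p + cnj (complex_of_real s))) = v (p + complex_of_real s)"
  proof eventually_elim
    case (elim s)
    from v_real[OF elim] show ?case by (simp add: Reals_cnj_iff)
  qed
qed

lemma V_nth_real: "V $ n = of_real (Re (V $ n))"
  using V_real by (metis fps_cnj_nth Reals_cnj_iff of_real_Re)

lemma s_init: "s 0 = fps_X"
proof -
  have "\<forall>\<^sub>F z in nhds p. (0, z) \<in> W"
    using eventually_nhds_in_open[OF open_slice[OF T0], of p] x0_W[OF T0] by simp
  then have "\<forall>\<^sub>F z in nhds 0. (0, p + z) \<in> W"
    by (simp add: nhds_to_0[of p] eventually_filtermap)
  then have "\<forall>\<^sub>F z in nhds 0. S 0 (p + z) - p = z"
    by eventually_elim (simp add: S_init)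
  from has_fps_expansion_cong[OF this refl, of "s 0"] have "(\<lambda>z. z) has_fps_expansion s 0"
    using s_expansion[OF T0] by simp
  then show ?thesis using has_fps_expansion_fps_X by (metis fps_expansion_eqI)
qed

lemma S_fixed: "t \<in> T \<Longrightarrow> S t p = p"
proof -
  assume t: "t \<in> T"
  have "((\<lambda>\<tau>. S \<tau> p - p) has_vector_derivative 0 * (S t p - p)) (at t within T)" if "t \<in> T" for t
    using has_vector_derivative_diff[OF pde[OF x0_W[OF that]] has_vector_derivative_const[of p]]
    by (simp add: v_x0)
  from linear_ode_zero[OF convex_T T0 t _ this] show ?thesis
    using S_init[OF x0_W[OF T0]] by simp
qed

lemma s_nth_0: "t \<in> T \<Longrightarrow> s t $ 0 = 0"
  by (simp add: s_def fps_expansion_def S_fixed)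

lemma deriv_S: "t \<in> T \<Longrightarrow> deriv (S t) p = s t $ 1"
  by (simp add: s_def fps_expansion_def)

text \<open>Passage from the partial differential equation to the system for the Taylor coefficients
  at \<open>x\<^sub>0\<close>.\<close>

lemma s_vderiv: "fps_vderiv T s (\<lambda>t. fps_const (- 2 * \<i>) * (V * fps_deriv (s t)))"
  unfolding fps_vderiv_def
proof (intro ballI allI)
  fix t0 n assume t0: "t0 \<in> T"
  obtain W' where W': "open W'" "W = (T \<times> UNIV) \<inter> W'" using W_open by (metis openin_open)
  have "(t0, p) \<in> W'" using x0_W[OF t0] W' by auto
  then obtain A B where AB: "open A" "open B" "(t0, p) \<in> A \<times> B" "A \<times> B \<subseteq> W'"
    using W'(1) by (metis open_prod_elim)
  then obtain e R where e: "e > 0" "ball t0 e \<subseteq> A" and R: "R > 0" "ball p R \<subseteq> B"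
    by (metis mem_Sigma_iff openE)
  \<comment> \<open>The slices of \<open>W\<close> vary with \<open>t\<close>, so a common disc
    around \<open>p\<close> is available only for times near \<open>t0\<close>. This suffices, a
    derivative being local.\<close>
  define I where "I = T \<inter> ball t0 e"
  have IT: "I \<subseteq> T" by (auto simp: I_def)
  have box: "(t, z) \<in> W" if "t \<in> I" "z \<in> ball p R" for t z
    using that e R AB W' unfolding I_def by blast
  have I: "convex I" "t0 \<in> I"
    using convex_T t0 e by (auto simp: I_def intro: convex_Int)
  have BU: "ball p R \<subseteq> U" using box I W_sub by blast
  have holS: "S t holomorphic_on ball p R" if "t \<in> I" for t
    using S_holo[of t] IT that box by (blast intro: holomorphic_on_subset)
  have holv: "v holomorphic_on ball p R" using v_holo BU by (rule holomorphic_on_subset)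
  let ?f' = "\<lambda>t z. - 2 * \<i> * v z * deriv (S t) z"
  have hol': "?f' t holomorphic_on ball p R" if "t \<in> I" for t
    by (intro holomorphic_intros holv holomorphic_deriv holS that open_ball)
  \<comment> \<open>Nested radii: continuity of \<open>S\<close> on the circle of radius
    \<open>R / 2\<close> gives continuity of its \<open>z\<close>-derivative inside, in particular
    on the circle of radius \<open>R / 3\<close>, which carries the Cauchy integral for the
    coefficients.\<close>
  have "continuous_on (I \<times> sphere p (R / 2)) (\<lambda>(t, z). S t z)"
    by (rule continuous_on_subset[OF S_cont]) (use box R in auto)
  then have "continuous_on (I \<times> ball p (R / 2)) (\<lambda>(t, z). deriv (S t) z)"
    by (rule continuous_on_deriv_param) (use R holS in auto)
  then have "continuous_on (I \<times> sphere p (R / 3)) (\<lambda>x. deriv (S (fst x)) (snd x))"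
    unfolding split_beta by (rule continuous_on_subset) (use R in auto)
  moreover have "continuous_on (I \<times> sphere p (R / 3)) (\<lambda>x. v (snd x))"
    by (rule continuous_on_compose2[OF holomorphic_on_imp_continuous_on[OF holv]])
      (use R in \<open>auto intro!: continuous_intros\<close>)
  ultimately have cont: "continuous_on (I \<times> sphere p (R / 3)) (\<lambda>(t, z). ?f' t z)"
    unfolding split_beta by (intro continuous_intros)
  have "((\<lambda>t. (deriv ^^ n) (S t) p) has_vector_derivative (deriv ^^ n) (?f' t0) p) (at t0 within I)"
  proof (rule higher_deriv_has_vector_derivative[OF _ _ I holS hol' _ cont])
    fix t z assume "t \<in> I" "z \<in> sphere p (R / 3)"
    then have "(t, z) \<in> W" using box R by auto
    from has_vector_derivative_within_subset[OF pde[OF this] IT]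
    show "((\<lambda>\<tau>. S \<tau> z) has_vector_derivative ?f' t z) (at t within I)" .
  qed (use R in auto)
  moreover have "at t0 within I = at t0 within T"
    by (rule at_within_nhd[of _ "ball t0 e"]) (use e in \<open>auto simp: I_def\<close>)
  ultimately have D: "((\<lambda>t. (deriv ^^ n) (S t) p) has_vector_derivative (deriv ^^ n) (?f' t0) p) (at t0 within T)"
    by simp
  have "((\<lambda>t. (deriv ^^ n) (S t) p / fact n - fps_const p $ n) has_vector_derivative
      (deriv ^^ n) (?f' t0) p / fact n - 0) (at t0 within T)"
    by (intro has_vector_derivative_diff has_vector_derivative_divide D has_vector_derivative_const)
  then have 1: "((\<lambda>t. s t $ n) has_vector_derivative fps_expansion (?f' t0) p $ n) (at t0 within T)"
    by (simp add: s_def fps_expansion_def)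
  have "fps_expansion (?f' t0) p = fps_const (- 2 * \<i>) * (V * fps_deriv (s t0))"
  proof (rule fps_expansion_eqI_shift)
    show "?f' t0 analytic_on {p}"
      using hol'[OF I(2)] R by (auto simp: analytic_at intro!: exI[of _ "ball p R"])
    have "deriv (\<lambda>z. S t0 (p + z)) has_fps_expansion fps_deriv (fps_expansion (S t0) p)"
      by (intro has_fps_expansion_deriv S_expansion t0)
    moreover have "deriv (\<lambda>z. S t0 (p + z)) = (\<lambda>z. deriv (S t0) (p + z))"
      by (rule ext) (simp add: deriv_shift_0' o_def add.assoc)
    moreover have "fps_deriv (fps_expansion (S t0) p) = fps_deriv (s t0)"
      by (simp add: s_def)
    ultimately have d: "(\<lambda>z. deriv (S t0) (p + z)) has_fps_expansion fps_deriv (s t0)"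
      by (simp only:)
    show "(\<lambda>x. ?f' t0 (p + x)) has_fps_expansion fps_const (- 2 * \<i>) * (V * fps_deriv (s t0))"
      unfolding mult.assoc[of _ "v _"]
      by (intro has_fps_expansion_mult V_expansion d has_fps_expansion_const)
  qed
  with 1 show "((\<lambda>\<tau>. s \<tau> $ n) has_vector_derivative
      (fps_const (- 2 * \<i>) * (V * fps_deriv (s t0))) $ n) (at t0 within T)"
    by simp
qed

lemmas s_coeffs = fps_flow_coeffs[OF convex_T T0 V_nth_0 s_vderiv s_init]

lemma schwarz_reflection:
  assumes t: "t \<in> T"
  shows "\<forall>\<^sub>F z in nhds p. S t (cnj (S t z)) = cnj z"
proof -
  have X: "fps_cnj (s t) oo s t = fps_X"
    by (rule fps_flow_reflection[OF convex_T T0 V_nth_0 V_real s_vderiv s_init s_nth_0 t])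
  have "((\<lambda>z. cnj (S t (p + cnj z) - p)) \<circ> (\<lambda>z. S t (p + z) - p)) has_fps_expansion fps_X"
    using has_fps_expansion_compose[OF has_fps_expansion_cnj[OF s_expansion[OF t]]
      s_expansion[OF t] s_nth_0[OF t]] unfolding X .
  then have "\<forall>\<^sub>F z in nhds 0. cnj (S t (p + cnj (S t (p + z) - p)) - p) = z"
    by (simp add: has_fps_expansion_def o_def eq_commute)
  then have "\<forall>\<^sub>F z in nhds 0. S t (cnj (S t (p + z))) = cnj (p + z)"
  proof eventually_elim
    case (elim z)
    then have "S t (cnj (S t (p + z))) - p = cnj z"
      by (metis add_diff_cancel_left' complex_cnj_cnj complex_cnj_complex_of_real complex_cnj_diff
        diff_add_cancel add.commute)
    then show ?case by (simp add: algebra_simps)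
  qed
  then show ?thesis
    by (simp add: nhds_to_0[of p] eventually_filtermap)
qed

text \<open>Taking real parts loses nothing, since all derivatives of \<open>v\<close> at
  \<open>p\<close> are real; see \<open>deriv_v\<close>.\<close>

definition v1 :: real where "v1 = Re (deriv v p)"
definition v2 :: real where "v2 = Re ((deriv ^^ 2) v p)"
definition v3 :: real where "v3 = Re ((deriv ^^ 3) v p)"

lemma deriv_v_real: "(deriv ^^ n) v p = of_real (Re ((deriv ^^ n) v p))"
proof -
  have "(deriv ^^ n) v p = fact n * V $ n"
    by (simp add: V_nth)
  then have "(deriv ^^ n) v p = of_real (fact n * Re (V $ n))"
    by (metis V_nth_real of_real_mult of_real_fact)
  then show ?thesis by (metis Re_complex_of_real)
qed

lemma deriv_v: "deriv v p = of_real v1" "(deriv ^^ 2) v p = of_real v2" "(deriv ^^ 3) v p = of_real v3"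
  using deriv_v_real[of 1] deriv_v_real[of 2] deriv_v_real[of 3] by (simp_all add: v1_def v2_def v3_def)

lemma V_nth_v: "V $ 1 = of_real v1" "V $ 2 = of_real v2 / 2" "V $ 3 = of_real v3 / 6"
  using deriv_v by (simp_all add: V_nth fact_numeral)

text \<open>The Schwarz function has derivative \<open>cis (- 2 * \<theta>)\<close> at a point with
  tangent angle \<open>\<theta>\<close>; hence the rotation is uniform, with angle
  \<open>v1 * t\<close>.\<close>

lemma deriv_S_cis: "t \<in> T \<Longrightarrow> s t $ 1 = cis (- 2 * (v1 * t))"
  using s_coeffs(1)[of t] unfolding V_nth_v cis_conv_exp by (simp add: mult_ac)

text \<open>The form required by \<open>image_jet_curvature\<close>, with \<open>a = v2 * t\<close>
  and \<open>b = v3 * t / 3\<close>.\<close>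

lemma s_coeffs_tangent:
  assumes "v1 = 0" "t \<in> T"
  shows "s t $ 1 = 1" "s t $ 2 = - \<i> * of_real (v2 * t)"
    "s t $ 3 = - \<i> * of_real (v3 * t / 3) + (s t $ 2)\<^sup>2"
  using s_coeffs[OF assms(2)] assms(1) unfolding V_nth_v by simp_all

end

section \<open>Residues of a reciprocal at simple and double zeros\<close>

lemma residue_inverse_fps:
  assumes f: "(\<lambda>z. f (p + z)) has_fps_expansion F" and "F = fps_X ^ Suc n * Q" "Q $ 0 \<noteq> 0"
  shows "residue (\<lambda>z. 1 / f z) p = inverse Q $ n"
proof -
  \<comment> \<open>The zero is divided out and the gap at 0 filled, so that the reciprocal of
    \<open>f\<close> becomes \<open>inverse (q z) / z ^ Suc n\<close>, whose residue is a Taylor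
    coefficient.\<close>
  define q where "q z = (if z = 0 then Q $ 0 else f (p + z) / z ^ Suc n)" for z
  have "F \<noteq> 0" and sd: "subdegree F = Suc n"
  proof -
    have "Q \<noteq> 0" "subdegree Q = 0" using assms(3) by auto
    then show "F \<noteq> 0" "subdegree F = Suc n" by (simp_all add: assms(2))
  qed
  have "fps_shift (Suc n) F = Q"
    by (simp add: assms(2) fps_shift_times_fps_X_power' mult.commute del: power_Suc)
  then have "q has_fps_expansion Q"
    using has_fps_expansion_shift[OF f, of "Suc n" "Q $ 0"] sd
    by (auto simp: q_def[abs_def])
  then have "(\<lambda>z. inverse (q z)) has_fps_expansion inverse Q"
    using assms(3) by (rule has_fps_expansion_inverse)
  then have "residue (\<lambda>z. inverse (q z) / z ^ Suc n) 0 = inverse Q $ n"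
    by (rule residue_fps_expansion_over_power_at_0)
  moreover have "residue (\<lambda>z. 1 / f (p + z)) 0 = residue (\<lambda>z. inverse (q z) / z ^ Suc n) 0"
    by (rule residue_cong) (auto simp: q_def eventually_at_filter field_simps intro!: always_eventually)
  ultimately show ?thesis by (subst residue_shift_0) simp
qed

lemma residue_inverse_simple_zero:
  assumes f: "(\<lambda>z. f (p + z)) has_fps_expansion F" and "F $ 0 = 0" "F $ 1 \<noteq> 0"
  shows "residue (\<lambda>z. 1 / f z) p = 1 / F $ 1"
proof -
  have "F = fps_X ^ Suc 0 * fps_shift 1 F"
    using assms(2) by (simp add: fps_eq_iff)
  from residue_inverse_fps[OF f this] show ?thesis
    using assms(3) by (simp add: divide_inverse)
qed

lemma residue_inverse_double_zero:
  assumes f: "(\<lambda>z. f (p + z)) has_fps_expansion F" and "F $ 0 = 0" "F $ 1 = 0" "F $ 2 \<noteq> 0"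
  shows "residue (\<lambda>z. 1 / f z) p = - (F $ 3) / (F $ 2)\<^sup>2"
proof -
  let ?Q = "fps_shift 2 F"
  have "F = fps_X ^ Suc 1 * ?Q"
    unfolding fps_eq_iff
  proof
    fix n :: nat
    have "n = 0 \<or> n = 1 \<or> (\<exists>m. n = Suc (Suc m))" by presburger
    then show "F $ n = (fps_X ^ Suc 1 * ?Q) $ n"
      using assms(2,3) by (auto simp: fps_X_power_mult_nth numeral_2_eq_2 simp del: power_Suc)
  qed
  from residue_inverse_fps[OF f this] have "residue (\<lambda>z. 1 / f z) p = inverse ?Q $ 1"
    using assms(4) by (simp add: numeral_2_eq_2)
  moreover have "inverse ?Q $ 1 = - (F $ 3) / (F $ 2)\<^sup>2"
  proof -
    \<comment> \<open>Comparing the coefficients of index 1 determines that of the inverse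
      series.\<close>
    have "inverse ?Q * ?Q = 1"
      using assms(4) by (intro inverse_mult_eq_1) (simp add: numeral_2_eq_2)
    from arg_cong[OF this, of "\<lambda>G. G $ 1"] have "inverse (F $ 2) * F $ 3 + inverse ?Q $ 1 * F $ 2 = 0"
      unfolding fps_mult_nth by (simp add: numeral_2_eq_2 numeral_3_eq_3)
    then show ?thesis using assms(4) by (simp add: field_simps power2_eq_square add_eq_0_iff)
  qed
  ultimately show ?thesis by simp
qed

section \<open>Tangent angle, curvature and Kasner invariant of the moving curve and its conformal
  images\<close>

context reflection_flow
begin

definition curve :: "real \<Rightarrow> complex set" where
  "curve t = {z. (t, z) \<in> W \<and> cnj z = S t z}"

lemma curve_local_param:
  assumes N: "open N" "p \<in> N" "\<phi> holomorphic_on N" "inj_on \<phi> N" and t: "t \<in> T"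
  obtains \<gamma> where "local_param (\<phi> ` (curve t \<inter> N)) (\<phi> p) \<gamma>"
    "velocity \<gamma> 0 = deriv \<phi> p * cis (v1 * t)"
proof -
  have "p \<in> {z. (t, z) \<in> W}" using x0_W[OF t] by simp
  from schwarz_local_param_image[OF N open_slice[OF t] this S_holo[OF t] schwarz_reflection[OF t], of "v1 * t"]
  obtain \<gamma> where "local_param (\<phi> ` ({z \<in> {z. (t, z) \<in> W}. cnj z = S t z} \<inter> N)) (\<phi> p) \<gamma>"
    "velocity \<gamma> 0 = deriv \<phi> p * cis (v1 * t)"
    using S_fixed[OF t] deriv_S[OF t] deriv_S_cis[OF t] by auto
  with that show ?thesis by (simp add: curve_def)
qed

text \<open>The real axis is the curve whose Schwarz function is the identity, with tangent angle
  0.\<close>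

lemma real_axis_local_param:
  assumes N: "open N" "p \<in> N" "\<phi> holomorphic_on N" "inj_on \<phi> N"
  obtains \<gamma> where "local_param (\<phi> ` (\<real> \<inter> N)) (\<phi> p) \<gamma>" "velocity \<gamma> 0 = deriv \<phi> p"
proof -
  have "{z \<in> UNIV. cnj z = z} = (\<real> :: complex set)" by (auto simp: Reals_cnj_iff)
  with schwarz_local_param_image[OF N open_UNIV UNIV_I, of "\<lambda>z. z" 0] that show ?thesis
    by (auto intro: holomorphic_on_ident)
qed

lemma curve_jet:
  assumes N: "open N" "p \<in> N" "\<phi> holomorphic_on N" "inj_on \<phi> N" and t: "t \<in> T"
    and \<gamma>: "local_param (\<phi> ` (curve t \<inter> N)) (\<phi> p) \<gamma>"
    and \<Phi>: "(\<lambda>z. \<phi> (p + z) - \<phi> p) has_fps_expansion \<Phi>"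
  obtains F where "F $ 0 = 0" "F $ 1 \<noteq> 0" "fps_cnj F = s t oo F"
    "velocity \<gamma> 0 = (\<Phi> oo F) $ 1"
    "signed_curvature \<gamma> 0 = 2 * Im ((\<Phi> oo F) $ 2 / (\<Phi> oo F) $ 1) / norm ((\<Phi> oo F) $ 1)"
    "arclength_deriv \<gamma> (signed_curvature \<gamma>) 0 =
       6 * Im ((\<Phi> oo F) $ 3 / (\<Phi> oo F) $ 1 - ((\<Phi> oo F) $ 2 / (\<Phi> oo F) $ 1)\<^sup>2) / (norm ((\<Phi> oo F) $ 1))\<^sup>2"
proof -
  have c: "cnj z = S t z" if "z \<in> curve t" for z using that by (simp add: curve_def)
  have e: "(\<lambda>z. S t (p + z) - cnj p) has_fps_expansion s t"
    using s_expansion[OF t] by simp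
  show ?thesis
    by (rule local_param_image_jet[OF N \<gamma> \<Phi> c e]) (assumption, rule that)
qed

lemma conformal_expansion:
  assumes N: "open N" "p \<in> N" "\<phi> holomorphic_on N" "inj_on \<phi> N"
  obtains \<Phi> where "(\<lambda>z. \<phi> (p + z) - \<phi> p) has_fps_expansion \<Phi>" "\<Phi> $ 1 = deriv \<phi> p" "\<Phi> $ 1 \<noteq> 0"
proof -
  let ?\<Phi> = "fps_expansion \<phi> p - fps_const (\<phi> p)"
  have "\<phi> analytic_on {p}" using N by (auto simp: analytic_at)
  then have "(\<lambda>z. \<phi> (p + z) - \<phi> p) has_fps_expansion ?\<Phi>"
    by (intro has_fps_expansion_diff analytic_at_imp_has_fps_expansion has_fps_expansion_const)
  moreover have "?\<Phi> $ 1 = deriv \<phi> p" by (simp add: fps_expansion_def)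
  moreover have "deriv \<phi> p \<noteq> 0"
    by (rule holomorphic_injective_imp_regular[OF N(3,1,4,2)])
  ultimately show ?thesis using that by metis
qed

lemma tangent_angle_curve:
  assumes N: "open N" "p \<in> N" "\<phi> holomorphic_on N" "inj_on \<phi> N" and t: "t \<in> T"
  shows "tangent_angle (\<phi> ` (curve t \<inter> N)) (\<phi> p) (Arg (deriv \<phi> p) + v1 * t)"
proof -
  obtain \<gamma> where \<gamma>: "local_param (\<phi> ` (curve t \<inter> N)) (\<phi> p) \<gamma>"
    "velocity \<gamma> 0 = deriv \<phi> p * cis (v1 * t)"
    by (rule curve_local_param[OF assms])
  have "deriv \<phi> p = of_real (norm (deriv \<phi> p)) * cis (Arg (deriv \<phi> p))"
    using rcis_cmod_Arg[of "deriv \<phi> p"] by (simp add: rcis_def)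
  then have "velocity \<gamma> 0 = of_real (norm (deriv \<phi> p)) * cis (Arg (deriv \<phi> p) + v1 * t)"
    unfolding \<gamma>(2) by (metis cis_mult mult.assoc)
  with \<gamma>(1) show ?thesis unfolding tangent_angle_def by blast
qed

lemma tangent_angle_curve_unique:
  assumes N: "open N" "p \<in> N" "\<phi> holomorphic_on N" "inj_on \<phi> N" and t: "t \<in> T"
    and \<alpha>: "tangent_angle (\<phi> ` (curve t \<inter> N)) (\<phi> p) \<alpha>"
  shows "(\<alpha> - Arg (deriv \<phi> p) - v1 * t) / pi \<in> \<int>"
proof -
  obtain \<gamma> r where \<gamma>: "local_param (\<phi> ` (curve t \<inter> N)) (\<phi> p) \<gamma>" and r: "velocity \<gamma> 0 = of_real r * cis \<alpha>"
    using \<alpha> unfolding tangent_angle_def by blast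
  obtain \<Phi> where \<Phi>: "(\<lambda>z. \<phi> (p + z) - \<phi> p) has_fps_expansion \<Phi>" "\<Phi> $ 1 = deriv \<phi> p" "\<Phi> $ 1 \<noteq> 0"
    by (rule conformal_expansion[OF N])
  obtain F where F: "F $ 0 = 0" "F $ 1 \<noteq> 0" "fps_cnj F = s t oo F" "velocity \<gamma> 0 = (\<Phi> oo F) $ 1"
    by (rule curve_jet[OF N t \<gamma> \<Phi>(1)])
  define c m where "c = Arg (deriv \<phi> p)" and "m = norm (deriv \<phi> p)"
  define \<beta> where "\<beta> = \<alpha> - c"
  have m: "deriv \<phi> p = of_real m * cis c" "m \<noteq> 0"
    using rcis_cmod_Arg[of "deriv \<phi> p"] \<Phi> by (simp_all add: rcis_def c_def m_def)
  have "of_real r * cis \<alpha> = of_real m * cis c * F $ 1"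
    using r F(4) fps_compose_nth_1_2_3(1)[OF F(1), of \<Phi>] \<Phi>(2) m(1) by simp
  moreover have "cis \<alpha> = cis c * cis \<beta>" by (simp add: \<beta>_def cis_mult)
  ultimately have "F $ 1 = of_real (r / m) * cis \<beta>"
    using m(2) by (simp add: field_simps)
  \<comment> \<open>A nonzero real factor, possibly negative, drops out of the conjugation relation,
    so only the direction \<open>cis \<beta>\<close> is constrained, and only up to sign.\<close>
  moreover from this F(2) have "r / m \<noteq> 0" by auto
  moreover have "cnj (F $ 1) = cis (- 2 * (v1 * t)) * F $ 1"
    using schwarz_jet_direction[OF F(1-3)] deriv_S_cis[OF t] by simp
  ultimately have "cis (- \<beta>) = cis (- 2 * (v1 * t)) * cis \<beta>"
    by (simp add: cis_cnj)
  then have "cis \<beta> * cis (- \<beta>) = cis \<beta> * (cis (- 2 * (v1 * t)) * cis \<beta>)" by simp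
  then have "cis (2 * (\<beta> - v1 * t)) = 1" by (simp add: cis_mult algebra_simps)
  then have "cos (2 * (\<beta> - v1 * t)) = 1" by (simp add: complex_eq_iff)
  then obtain n :: int where "2 * (\<beta> - v1 * t) = of_int n * 2 * pi" unfolding cos_one_2pi_int by (elim exE)
  then have "(\<alpha> - c - v1 * t) / pi = of_int n" by (simp add: \<beta>_def field_simps)
  then show ?thesis by (simp add: c_def)
qed

text \<open>The map \<open>\<phi>\<close> adds only the constant \<open>Arg (deriv \<phi> p)\<close>
  to the angle. Any continuous choice differs from the explicit one by a multiple of
  \<open>pi\<close> that is continuous in \<open>t\<close>, hence constant on the interval.\<close>

lemma rotation_rate:
  assumes N: "open N" "p \<in> N" "\<phi> holomorphic_on N" "inj_on \<phi> N"
  shows "\<exists>\<theta>. tangent_angle_on T (\<lambda>t. \<phi> ` (curve t \<inter> N)) (\<phi> p) \<theta>"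
    and "tangent_angle_on T (\<lambda>t. \<phi> ` (curve t \<inter> N)) (\<phi> p) \<theta> \<Longrightarrow> t \<in> T \<Longrightarrow>
      ((\<lambda>t. complex_of_real (\<theta> t)) has_vector_derivative deriv v p) (at t within T)"
proof -
  let ?\<theta> = "\<lambda>t. Arg (deriv \<phi> p) + v1 * t"
  have "tangent_angle_on T (\<lambda>t. \<phi> ` (curve t \<inter> N)) (\<phi> p) ?\<theta>"
    unfolding tangent_angle_on_def
    by (intro conjI ballI tangent_angle_curve[OF N] continuous_intros)
  then show "\<exists>\<theta>. tangent_angle_on T (\<lambda>t. \<phi> ` (curve t \<inter> N)) (\<phi> p) \<theta>" by blast
  assume \<theta>: "tangent_angle_on T (\<lambda>t. \<phi> ` (curve t \<inter> N)) (\<phi> p) \<theta>" and t: "t \<in> T"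
  let ?k = "\<lambda>t. (\<theta> t - Arg (deriv \<phi> p) - v1 * t) / pi"
  have "continuous_on T ?k"
    using \<theta> unfolding tangent_angle_on_def by (intro continuous_intros) auto
  moreover have "?k t \<in> \<int>" if "t \<in> T" for t
    using \<theta> tangent_angle_curve_unique[OF N that] that unfolding tangent_angle_on_def by blast
  ultimately have "?k \<tau> = ?k t" if "\<tau> \<in> T" for \<tau>
    using continuous_integer_valued_const[of T ?k] convex_connected[OF convex_T] that t by blast
  then have eq: "\<theta> \<tau> = \<theta> t + v1 * (\<tau> - t)" if "\<tau> \<in> T" for \<tau>
    using that by (simp add: field_simps)
  have "((\<lambda>\<tau>. complex_of_real (\<theta> t + v1 * (\<tau> - t))) has_vector_derivative of_real v1) (at t within T)"
    by (auto intro!: derivative_eq_intros)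
  then show "((\<lambda>t. complex_of_real (\<theta> t)) has_vector_derivative deriv v p) (at t within T)"
    unfolding deriv_v(1) by (rule has_vector_derivative_transform[OF t, rotated]) (use eq in auto)
qed

lemma curve_param_curvature:
  assumes N: "open N" "p \<in> N" "\<phi> holomorphic_on N" "inj_on \<phi> N" and t: "t \<in> T" and v1: "v1 = 0"
    and \<gamma>: "local_param (\<phi> ` (curve t \<inter> N)) (\<phi> p) \<gamma>"
    and \<Phi>: "(\<lambda>z. \<phi> (p + z) - \<phi> p) has_fps_expansion \<Phi>" "\<Phi> $ 1 \<noteq> 0"
  obtains x where "x \<noteq> 0" "velocity \<gamma> 0 = \<Phi> $ 1 * of_real x"
    "signed_curvature \<gamma> 0 = sgn x * (v2 * t + 2 * Im (\<Phi> $ 2 / \<Phi> $ 1)) / norm (\<Phi> $ 1)"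
    "arclength_deriv \<gamma> (signed_curvature \<gamma>) 0 =
       (v3 * t + 6 * Im (\<Phi> $ 3 / \<Phi> $ 1 - (\<Phi> $ 2 / \<Phi> $ 1)\<^sup>2)) / (norm (\<Phi> $ 1))\<^sup>2"
proof -
  obtain F where F: "F $ 0 = 0" "F $ 1 \<noteq> 0" "fps_cnj F = s t oo F" and vel: "velocity \<gamma> 0 = (\<Phi> oo F) $ 1"
    "signed_curvature \<gamma> 0 = 2 * Im ((\<Phi> oo F) $ 2 / (\<Phi> oo F) $ 1) / norm ((\<Phi> oo F) $ 1)"
    "arclength_deriv \<gamma> (signed_curvature \<gamma>) 0 =
       6 * Im ((\<Phi> oo F) $ 3 / (\<Phi> oo F) $ 1 - ((\<Phi> oo F) $ 2 / (\<Phi> oo F) $ 1)\<^sup>2) / (norm ((\<Phi> oo F) $ 1))\<^sup>2"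
    by (rule curve_jet[OF N t \<gamma> \<Phi>(1)])
  note j = image_jet_curvature[OF F s_coeffs_tangent[OF v1 t] \<Phi>(2)]
  have "Re (F $ 1) \<noteq> 0" using j(1) F(2) by (simp add: complex_eq_iff)
  with vel j(2-4) that[of "Re (F $ 1)"] show ?thesis by simp
qed

lemma real_axis_param_curvature:
  assumes N: "open N" "p \<in> N" "\<phi> holomorphic_on N" "inj_on \<phi> N"
    and \<gamma>: "local_param (\<phi> ` (\<real> \<inter> N)) (\<phi> p) \<gamma>"
    and \<Phi>: "(\<lambda>z. \<phi> (p + z) - \<phi> p) has_fps_expansion \<Phi>" "\<Phi> $ 1 \<noteq> 0"
  obtains x where "x \<noteq> 0" "velocity \<gamma> 0 = \<Phi> $ 1 * of_real x"
    "signed_curvature \<gamma> 0 = sgn x * (2 * Im (\<Phi> $ 2 / \<Phi> $ 1)) / norm (\<Phi> $ 1)"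
    "arclength_deriv \<gamma> (signed_curvature \<gamma>) 0 =
       6 * Im (\<Phi> $ 3 / \<Phi> $ 1 - (\<Phi> $ 2 / \<Phi> $ 1)\<^sup>2) / (norm (\<Phi> $ 1))\<^sup>2"
proof -
  have r: "cnj z = z" if "z \<in> \<real>" for z using that by (simp add: Reals_cnj_iff)
  have e: "(\<lambda>z. (p + z) - cnj p) has_fps_expansion fps_X"
    using has_fps_expansion_fps_X by simp
  obtain F where F: "F $ 0 = 0" "F $ 1 \<noteq> 0" "fps_cnj F = fps_X oo F" and vel: "velocity \<gamma> 0 = (\<Phi> oo F) $ 1"
    "signed_curvature \<gamma> 0 = 2 * Im ((\<Phi> oo F) $ 2 / (\<Phi> oo F) $ 1) / norm ((\<Phi> oo F) $ 1)"
    "arclength_deriv \<gamma> (signed_curvature \<gamma>) 0 =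
       6 * Im ((\<Phi> oo F) $ 3 / (\<Phi> oo F) $ 1 - ((\<Phi> oo F) $ 2 / (\<Phi> oo F) $ 1)\<^sup>2) / (norm ((\<Phi> oo F) $ 1))\<^sup>2"
    by (rule local_param_image_jet[OF N \<gamma> \<Phi>(1) r e])
  \<comment> \<open>The real axis is the case \<open>a = b = 0\<close>.\<close>
  have "fps_X $ 1 = (1::complex)" "fps_X $ 2 = - \<i> * of_real 0" "fps_X $ 3 = - \<i> * of_real 0 + (fps_X $ 2)\<^sup>2"
    by (simp_all add: fps_X_def)
  note j = image_jet_curvature[OF F this \<Phi>(2)]
  have "Re (F $ 1) \<noteq> 0" using j(1) F(2) by (simp add: complex_eq_iff)
  with vel j(2-4) that[of "Re (F $ 1)"] show ?thesis by simp
qed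

text \<open>Taking differences cancels the contributions of \<open>\<phi>\<close> and leaves
  \<open>v2 * t / n\<close> up to sign and \<open>v3 * t / n\<^sup>2\<close>, where \<open>n\<close>
  is the modulus of the derivative of \<open>\<phi>\<close>; in the quotient \<open>n\<close>
  disappears. For \<open>t = 0\<close> or \<open>v3 = 0\<close> both sides are 0 by
  \<open>x / 0 = 0\<close>.\<close>

lemma kasner_curve:
  assumes N: "open N" "p \<in> N" "\<phi> holomorphic_on N" "inj_on \<phi> N" and t: "t \<in> T" and v1: "v1 = 0"
  shows "kasner (\<phi> ` (curve t \<inter> N)) (\<phi> ` (\<real> \<inter> N)) (\<phi> p) = v2\<^sup>2 / v3 * t"
  unfolding kasner_def
proof (rule the_equality)
  obtain \<Phi> where \<Phi>: "(\<lambda>z. \<phi> (p + z) - \<phi> p) has_fps_expansion \<Phi>" "\<Phi> $ 1 = deriv \<phi> p" "\<Phi> $ 1 \<noteq> 0"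
    by (rule conformal_expansion[OF N])
  have *: "(signed_curvature \<gamma>1 0 - signed_curvature \<gamma>2 0)\<^sup>2 /
            (arclength_deriv \<gamma>1 (signed_curvature \<gamma>1) 0 - arclength_deriv \<gamma>2 (signed_curvature \<gamma>2) 0)
            = v2\<^sup>2 / v3 * t"
    if \<gamma>1: "local_param (\<phi> ` (curve t \<inter> N)) (\<phi> p) \<gamma>1" and \<gamma>2: "local_param (\<phi> ` (\<real> \<inter> N)) (\<phi> p) \<gamma>2"
      and r: "r > 0" "velocity \<gamma>1 0 = of_real r * velocity \<gamma>2 0" for \<gamma>1 \<gamma>2 r
  proof -
    define n M L where "n = norm (\<Phi> $ 1)" and "M = Im (\<Phi> $ 2 / \<Phi> $ 1)"
      and "L = Im (\<Phi> $ 3 / \<Phi> $ 1 - (\<Phi> $ 2 / \<Phi> $ 1)\<^sup>2)"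
    obtain x where x: "x \<noteq> 0" "velocity \<gamma>1 0 = \<Phi> $ 1 * of_real x"
      "signed_curvature \<gamma>1 0 = sgn x * (v2 * t + 2 * M) / n"
      "arclength_deriv \<gamma>1 (signed_curvature \<gamma>1) 0 = (v3 * t + 6 * L) / n\<^sup>2"
      unfolding n_def M_def L_def by (rule curve_param_curvature[OF N t v1 \<gamma>1 \<Phi>(1,3)])
    obtain y where y: "y \<noteq> 0" "velocity \<gamma>2 0 = \<Phi> $ 1 * of_real y"
      "signed_curvature \<gamma>2 0 = sgn y * (2 * M) / n"
      "arclength_deriv \<gamma>2 (signed_curvature \<gamma>2) 0 = 6 * L / n\<^sup>2"
      unfolding n_def M_def L_def by (rule real_axis_param_curvature[OF N \<gamma>2 \<Phi>(1,3)])
    have "\<Phi> $ 1 * of_real x = \<Phi> $ 1 * of_real (r * y)"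
      using r(2) x(2) y(2) by (simp add: mult_ac)
    \<comment> \<open>Equal directions at the contact point force equal signs of \<open>x\<close>
      and \<open>y\<close>, so both curvatures carry the same orientation sign.\<close>
    then have "x = r * y" using \<Phi>(3) by (simp del: of_real_mult)
    then have sg: "sgn x = sgn y" using r(1) by (simp add: sgn_mult)
    have n: "n > 0" using \<Phi>(3) by (simp add: n_def)
    have "signed_curvature \<gamma>1 0 - signed_curvature \<gamma>2 0 = sgn y * (v2 * t) / n"
      unfolding x(3) y(3) sg by (simp add: diff_divide_distrib[symmetric] algebra_simps)
    moreover have "(sgn y)\<^sup>2 = 1" using y(1) by (simp add: sgn_if)
    ultimately have "(signed_curvature \<gamma>1 0 - signed_curvature \<gamma>2 0)\<^sup>2 = (v2 * t)\<^sup>2 / n\<^sup>2"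
      by (simp add: power_mult_distrib power_divide)
    moreover have "arclength_deriv \<gamma>1 (signed_curvature \<gamma>1) 0 - arclength_deriv \<gamma>2 (signed_curvature \<gamma>2) 0 = v3 * t / n\<^sup>2"
      unfolding x(4) y(4) by (simp add: diff_divide_distrib[symmetric])
    ultimately show ?thesis
      using n by (simp add: power2_eq_square)
  qed
  obtain \<gamma>1 where \<gamma>1: "local_param (\<phi> ` (curve t \<inter> N)) (\<phi> p) \<gamma>1" "velocity \<gamma>1 0 = deriv \<phi> p * cis (v1 * t)"
    by (rule curve_local_param[OF N t])
  obtain \<gamma>2 where \<gamma>2: "local_param (\<phi> ` (\<real> \<inter> N)) (\<phi> p) \<gamma>2" "velocity \<gamma>2 0 = deriv \<phi> p"
    by (rule real_axis_local_param[OF N])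
  have "velocity \<gamma>1 0 = of_real 1 * velocity \<gamma>2 0" using \<gamma>1(2) \<gamma>2(2) v1 by simp
  note e = this *[OF \<gamma>1(1) \<gamma>2(1) zero_less_one this]
  show "\<exists>\<gamma>1 \<gamma>2. local_param (\<phi> ` (curve t \<inter> N)) (\<phi> p) \<gamma>1 \<and> local_param (\<phi> ` (\<real> \<inter> N)) (\<phi> p) \<gamma>2 \<and>
      (\<exists>r>0. velocity \<gamma>1 0 = of_real r * velocity \<gamma>2 0) \<and>
      v2\<^sup>2 / v3 * t = (signed_curvature \<gamma>1 0 - signed_curvature \<gamma>2 0)\<^sup>2 /
            (arclength_deriv \<gamma>1 (signed_curvature \<gamma>1) 0 - arclength_deriv \<gamma>2 (signed_curvature \<gamma>2) 0)"
    using \<gamma>1(1) \<gamma>2(1) e(1) e(2)[symmetric] zero_less_one by blast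
  show "k = v2\<^sup>2 / v3 * t" if "\<exists>\<gamma>1 \<gamma>2. local_param (\<phi> ` (curve t \<inter> N)) (\<phi> p) \<gamma>1 \<and> local_param (\<phi> ` (\<real> \<inter> N)) (\<phi> p) \<gamma>2 \<and>
      (\<exists>r>0. velocity \<gamma>1 0 = of_real r * velocity \<gamma>2 0) \<and>
      k = (signed_curvature \<gamma>1 0 - signed_curvature \<gamma>2 0)\<^sup>2 /
            (arclength_deriv \<gamma>1 (signed_curvature \<gamma>1) 0 - arclength_deriv \<gamma>2 (signed_curvature \<gamma>2) 0)" for k
    using that * by blast
qed

lemma kasner_rate:
  assumes N: "open N" "p \<in> N" "\<phi> holomorphic_on N" "inj_on \<phi> N" and t: "t \<in> T" and v1: "deriv v p = 0"
  shows "((\<lambda>t. complex_of_real (kasner (\<phi> ` (curve t \<inter> N)) (\<phi> ` (\<real> \<inter> N)) (\<phi> p))) has_vector_derivative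
           ((deriv ^^ 2) v p)\<^sup>2 / (deriv ^^ 3) v p) (at t within T)"
proof -
  have v1: "v1 = 0" using v1 by (simp add: v1_def)
  have "((\<lambda>t. complex_of_real (v2\<^sup>2 / v3 * t)) has_vector_derivative of_real (v2\<^sup>2 / v3)) (at t within T)"
    by (auto intro!: derivative_eq_intros)
  moreover have "((deriv ^^ 2) v p)\<^sup>2 / (deriv ^^ 3) v p = of_real (v2\<^sup>2 / v3)"
    unfolding deriv_v by simp
  moreover have "complex_of_real (kasner (\<phi> ` (curve t \<inter> N)) (\<phi> ` (\<real> \<inter> N)) (\<phi> p)) = of_real (v2\<^sup>2 / v3 * t)"
    if "t \<in> T" for t
    by (simp only: kasner_curve[OF N that v1])
  ultimately show ?thesis
    by (simp only:) (rule has_vector_derivative_transform[OF t])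
qed

text \<open>The case of the identity map, \<open>\<Phi> = fps_X\<close>; positivity of
  \<open>r\<close> fixes the sign of the curvature. Independence of the parametrization is what
  makes the descriptions by \<open>THE\<close> meaningful.\<close>

lemma curve_param_curvature_id:
  assumes "t \<in> T" "v1 = 0" "local_param (curve t) p \<gamma>" "r > 0" "velocity \<gamma> 0 = of_real r"
  shows "signed_curvature \<gamma> 0 = v2 * t" "arclength_deriv \<gamma> (signed_curvature \<gamma>) 0 = v3 * t"
proof -
  have \<gamma>: "local_param ((\<lambda>z. z) ` (curve t \<inter> UNIV)) p \<gamma>" using assms(3) by simp
  obtain x where x: "x \<noteq> 0" "velocity \<gamma> 0 = fps_X $ 1 * of_real x"
    "signed_curvature \<gamma> 0 = sgn x * (v2 * t + 2 * Im (fps_X $ 2 / fps_X $ 1)) / norm (fps_X $ 1 :: complex)"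
    "arclength_deriv \<gamma> (signed_curvature \<gamma>) 0 =
       (v3 * t + 6 * Im (fps_X $ 3 / fps_X $ 1 - (fps_X $ 2 / fps_X $ 1)\<^sup>2)) / (norm (fps_X $ 1 :: complex))\<^sup>2"
    by (rule curve_param_curvature[OF open_UNIV UNIV_I holomorphic_on_ident inj_on_id2 assms(1,2) \<gamma>, of fps_X])
      (use has_fps_expansion_fps_X in auto)
  moreover from x(2) assms(5) have "x = r" by (simp add: fps_X_def)
  ultimately show "signed_curvature \<gamma> 0 = v2 * t" "arclength_deriv \<gamma> (signed_curvature \<gamma>) 0 = v3 * t"
    using assms(4) by (simp_all add: fps_X_def)
qed

lemma curve_param_id:
  assumes "t \<in> T" "v1 = 0"
  obtains \<gamma> where "local_param (curve t) p \<gamma>" "velocity \<gamma> 0 = 1"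
  by (rule curve_local_param[OF open_UNIV UNIV_I holomorphic_on_ident inj_on_id2 assms(1)])
    (use assms(2) in auto)

lemma curvature_at_curve:
  assumes "t \<in> T" "v1 = 0"
  shows "curvature_at (curve t) p 1 = v2 * t"
  unfolding curvature_at_def
proof (rule the_equality)
  obtain \<gamma> where "local_param (curve t) p \<gamma>" "velocity \<gamma> 0 = 1"
    by (rule curve_param_id[OF assms])
  moreover from this have "signed_curvature \<gamma> 0 = v2 * t"
    using curve_param_curvature_id[OF assms, of \<gamma> 1] by simp
  ultimately show "\<exists>\<gamma>. local_param (curve t) p \<gamma> \<and> (\<exists>r>0. velocity \<gamma> 0 = of_real r * 1) \<and>
      v2 * t = signed_curvature \<gamma> 0"
    by (intro exI[of _ \<gamma>] conjI exI[of _ 1]) auto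
qed (use curve_param_curvature_id[OF assms] in auto)

lemma curvature_s_at_curve:
  assumes "t \<in> T" "v1 = 0"
  shows "curvature_s_at (curve t) p 1 = v3 * t"
  unfolding curvature_s_at_def
proof (rule the_equality)
  obtain \<gamma> where "local_param (curve t) p \<gamma>" "velocity \<gamma> 0 = 1"
    by (rule curve_param_id[OF assms])
  moreover from this have "arclength_deriv \<gamma> (signed_curvature \<gamma>) 0 = v3 * t"
    using curve_param_curvature_id[OF assms, of \<gamma> 1] by simp
  ultimately show "\<exists>\<gamma>. local_param (curve t) p \<gamma> \<and> (\<exists>r>0. velocity \<gamma> 0 = of_real r * 1) \<and>
      v3 * t = arclength_deriv \<gamma> (signed_curvature \<gamma>) 0"
    by (intro exI[of _ \<gamma>] conjI exI[of _ 1]) auto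
qed (use curve_param_curvature_id[OF assms] in auto)

lemma curvature_rates:
  assumes "t \<in> T" "v1 = 0"
  shows "((\<lambda>t. curvature_at (curve t) p 1) has_real_derivative v2) (at t within T)"
    and "((\<lambda>t. curvature_s_at (curve t) p 1) has_real_derivative v3) (at t within T)"
proof -
  have d: "((\<lambda>t. c * t) has_real_derivative c) (at t within T)" for c
    by (auto intro!: derivative_eq_intros)
  show "((\<lambda>t. curvature_at (curve t) p 1) has_real_derivative v2) (at t within T)"
    by (rule has_field_derivative_transform_within[OF d zero_less_one assms(1)])
      (simp add: curvature_at_curve[OF _ assms(2)])
  show "((\<lambda>t. curvature_s_at (curve t) p 1) has_real_derivative v3) (at t within T)"
    by (rule has_field_derivative_transform_within[OF d zero_less_one assms(1)])
      (simp add: curvature_s_at_curve[OF _ assms(2)])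
qed

lemma residue_simple_zero: "deriv v p \<noteq> 0 \<Longrightarrow> deriv v p = 1 / residue (\<lambda>z. 1 / v z) p"
  using residue_inverse_simple_zero[OF V_expansion V_nth_0] by (simp add: V_nth)

text \<open>With \<open>V $ 2 = a / 2\<close> and \<open>V $ 3 = b / 6\<close> the residue is
  \<open>- 2 * b / (3 * a\<^sup>2)\<close>; being nonzero, it forces
  \<open>b \<noteq> 0\<close>.\<close>

lemma residue_double_zero:
  assumes "deriv v p = 0" "(deriv ^^ 2) v p \<noteq> 0" "residue (\<lambda>z. 1 / v z) p \<noteq> 0"
  shows "((deriv ^^ 2) v p)\<^sup>2 / (deriv ^^ 3) v p = - 2 / (3 * residue (\<lambda>z. 1 / v z) p)"
proof -
  define a b where "a = (deriv ^^ 2) v p" and "b = (deriv ^^ 3) v p"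
  have V: "V $ 1 = 0" "V $ 2 = a / 2" "V $ 3 = b / 6"
    using assms(1) by (simp_all add: V_nth a_def b_def fact_numeral)
  have a: "a \<noteq> 0" using assms(2) by (simp add: a_def)
  then have res: "residue (\<lambda>z. 1 / v z) p = - (b / 6) / (a / 2)\<^sup>2"
    using residue_inverse_double_zero[OF V_expansion V_nth_0 V(1)] unfolding V by (simp del: of_nat_Suc)
  then have "b \<noteq> 0" using assms(3) by auto
  with a show ?thesis
    unfolding a_def[symmetric] b_def[symmetric] res by (simp add: field_simps power2_eq_square)
qed

end

theorem proposition12:
  fixes v :: "complex \<Rightarrow> complex" and S :: "real \<Rightarrow> complex \<Rightarrow> complex"
    and \<Gamma> :: "real \<Rightarrow> complex set" and U :: "complex set"
    and T :: "real set" and W :: "(real \<times> complex) set"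
    and x\<^sub>0 :: real and res :: complex
  assumes "open U" and "v holomorphic_on U"
    and "\<And>x::real. of_real x \<in> U \<Longrightarrow> v (of_real x) \<in> \<real>"
    and "is_interval T" and "0 \<in> T"
    and "openin (top_of_set (T \<times> UNIV)) W" and "W \<subseteq> T \<times> U"
    and "continuous_on W (\<lambda>(t, z). S t z)"
    and "\<And>t. t \<in> T \<Longrightarrow> S t holomorphic_on {z. (t, z) \<in> W}"
    and "\<And>t z. (t, z) \<in> W \<Longrightarrow>
           ((\<lambda>\<tau>. S \<tau> z) has_vector_derivative - 2 * \<i> * v z * deriv (S t) z) (at t within T)"
    and "\<And>z. (0, z) \<in> W \<Longrightarrow> S 0 z = z"
    and "\<And>t. \<Gamma> t = {z. (t, z) \<in> W \<and> cnj z = S t z}"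
    and "v (of_real x\<^sub>0) = 0" and "\<And>t. t \<in> T \<Longrightarrow> (t, of_real x\<^sub>0) \<in> W"
    and "res = residue (\<lambda>z. 1 / v z) (of_real x\<^sub>0)"
  shows "(\<exists>\<theta>. tangent_angle_on T \<Gamma> (of_real x\<^sub>0) \<theta>) \<and>
     (\<forall>\<theta>. tangent_angle_on T \<Gamma> (of_real x\<^sub>0) \<theta> \<longrightarrow>
        (\<forall>t\<in>T. ((\<lambda>t. complex_of_real (\<theta> t)) has_vector_derivative deriv v (of_real x\<^sub>0))
                 (at t within T))) \<and>
     (deriv v (of_real x\<^sub>0) \<noteq> 0 \<longrightarrow> deriv v (of_real x\<^sub>0) = 1 / res) \<and>
     (deriv v (of_real x\<^sub>0) = 0 \<longrightarrow>
        (\<forall>t\<in>T. tangent_angle (\<Gamma> t) (of_real x\<^sub>0) 0) \<and>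
        (\<exists>c. \<forall>t\<in>T. ((\<lambda>t. curvature_at (\<Gamma> t) (of_real x\<^sub>0) 1) has_real_derivative c)
                       (at t within T)) \<and>
        (\<exists>c. \<forall>t\<in>T. ((\<lambda>t. curvature_s_at (\<Gamma> t) (of_real x\<^sub>0) 1) has_real_derivative c)
                       (at t within T)) \<and>
        (res \<noteq> 0 \<longrightarrow>
          (\<forall>t\<in>T. ((\<lambda>t. complex_of_real (kasner (\<Gamma> t) \<real> (of_real x\<^sub>0))) has_vector_derivative
                     ((deriv ^^ 2) v (of_real x\<^sub>0))\<^sup>2 / (deriv ^^ 3) v (of_real x\<^sub>0))
                   (at t within T)) \<and>
          ((deriv ^^ 2) v (of_real x\<^sub>0) \<noteq> 0 \<longrightarrow>
            ((deriv ^^ 2) v (of_real x\<^sub>0))\<^sup>2 / (deriv ^^ 3) v (of_real x\<^sub>0) = - 2 / (3 * res)))) \<and>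
     (\<forall>N \<phi>. open N \<and> of_real x\<^sub>0 \<in> N \<and> \<phi> holomorphic_on N \<and> inj_on \<phi> N \<longrightarrow>
        (\<exists>\<theta>. tangent_angle_on T (\<lambda>t. \<phi> ` (\<Gamma> t \<inter> N)) (\<phi> (of_real x\<^sub>0)) \<theta>) \<and>
        (\<forall>\<theta>. tangent_angle_on T (\<lambda>t. \<phi> ` (\<Gamma> t \<inter> N)) (\<phi> (of_real x\<^sub>0)) \<theta> \<longrightarrow>
           (\<forall>t\<in>T. ((\<lambda>t. complex_of_real (\<theta> t)) has_vector_derivative deriv v (of_real x\<^sub>0))
                    (at t within T))) \<and>
        (deriv v (of_real x\<^sub>0) = 0 \<and> res \<noteq> 0 \<longrightarrow>
           (\<forall>t\<in>T. ((\<lambda>t. complex_of_real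
                          (kasner (\<phi> ` (\<Gamma> t \<inter> N)) (\<phi> ` (\<real> \<inter> N)) (\<phi> (of_real x\<^sub>0))))
                     has_vector_derivative
                       ((deriv ^^ 2) v (of_real x\<^sub>0))\<^sup>2 / (deriv ^^ 3) v (of_real x\<^sub>0))
                    (at t within T))))"
proof -
  interpret reflection_flow v S U T W x\<^sub>0
    using assms by unfold_locales
  have \<Gamma>: "\<Gamma> = curve"
    using assms(12) by (simp add: curve_def fun_eq_iff)
  have res: "res = residue (\<lambda>z. 1 / v z) p" by fact
  \<comment> \<open>The claims about the curve itself are those about its conformal images for the
    identity map on \<open>UNIV\<close>.\<close>
  note id = open_UNIV UNIV_I holomorphic_on_ident inj_on_id2
  have rot: "\<exists>\<theta>. tangent_angle_on T \<Gamma> p \<theta>"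
    "tangent_angle_on T \<Gamma> p \<theta> \<Longrightarrow> t \<in> T \<Longrightarrow>
      ((\<lambda>t. complex_of_real (\<theta> t)) has_vector_derivative deriv v p) (at t within T)" for \<theta> t
    using rotation_rate[OF id] by (simp_all add: \<Gamma>)
  have kas: "((\<lambda>t. complex_of_real (kasner (\<Gamma> t) \<real> p)) has_vector_derivative
      ((deriv ^^ 2) v p)\<^sup>2 / (deriv ^^ 3) v p) (at t within T)" if "deriv v p = 0" "t \<in> T" for t
    using kasner_rate[OF id that(2,1)] by (simp add: \<Gamma>)
  have tan: "tangent_angle (\<Gamma> t) p 0" if "deriv v p = 0" "t \<in> T" for t
    using tangent_angle_curve[OF id that(2)] that(1) by (simp add: \<Gamma> v1_def)
  have cur: "\<exists>c. \<forall>t\<in>T. ((\<lambda>t. curvature_at (\<Gamma> t) p 1) has_real_derivative c) (at t within T)"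
    "\<exists>c. \<forall>t\<in>T. ((\<lambda>t. curvature_s_at (\<Gamma> t) p 1) has_real_derivative c) (at t within T)"
    if "deriv v p = 0"
    using curvature_rates that unfolding \<Gamma> by (auto simp: v1_def)
  show ?thesis
    unfolding res
    by (intro conjI allI impI ballI)
      (use rot kas tan cur residue_simple_zero residue_double_zero rotation_rate kasner_rate in \<open>auto simp: \<Gamma>\<close>)
qed

end
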